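(* Consider the functions $A,N:\mathbb{N}\to\mathbb{N}$ given by $A(0)=N(0)=0$, and $A(n)=A_n$ and $N(n)=N_n$ for $n>0$. Then $$N(n)-A(n)=n^{o(1)}\,2^{\frac{n}{4}}.$$
   Context: $\mathbb{N}$ is the set of nonnegative integers. A numerical semigroup is a subset $S\subseteq\mathbb{N}$ that contains $0$, is closed under addition, and has finite complement in $\mathbb{N}$. Every numerical semigroup $S$ has a unique minimal generating set, which is finite; it is denoted $P(S)$ and its elements are called primitives. For $S\neq\mathbb{N}$ the Frobenius number $F(S)$ is the largest element of $\mathbb{N}\setminus S$; by convention $F(\mathbb{N})=-1$. For a positive integer $n$, $A_n$ denotes the number of numerical semigroups $S$ with $\max P(S)=n$, and $N_n$ denotes the number of numerical semigroups $S$ with $F(S)=n$. Asymptotic notation: for functions $f,g$ on $\mathbb{N}$, one writes $f(n)=o(g(n))$ when $\lim_{n\to\infty}\frac{f(n)}{g(n)}=0$ and there is some $n_0\in\mathbb{N}$ such that $g(n)\neq 0$ for all $n>n_0$. For a function $C:\mathbb{N}\to\mathbb{N}$, one writes $C(n)=n^{o(1)}$ to denote that $\log(C(n))=o(\log n)$.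
   Formalization: Equality for all n is false: N(p)-A(p)=1 for primes p, and the lower bound fails for all large odd n. Proved instead: |N(n)-A(n)| <= C(n)2^{n/4} for all n with integer-valued C(n)=n^{o(1)}, and exact equality for all even n with real-valued C(n)=n^{o(1)}. *)

theory Defs
  imports Complex_Main "HOL-Library.Landau_Symbols"
begin

definition submonoid :: "nat set \<Rightarrow> bool" where
  "submonoid S \<longleftrightarrow> 0 \<in> S \<and> (\<forall>a\<in>S. \<forall>b\<in>S. a + b \<in> S)"

definition numerical_semigroup :: "nat set \<Rightarrow> bool" where
  "numerical_semigroup S \<longleftrightarrow> submonoid S \<and> finite (- S)"

definition minimal_generating_set :: "nat set \<Rightarrow> nat set \<Rightarrow> bool" where
  "minimal_generating_set G S \<longleftrightarrow>
     submonoid hull G = S \<and> (\<forall>H. H \<subset> G \<longrightarrow> submonoid hull H \<noteq> S)"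

(* Well defined by ex1_minimal_generating_set below. *)
definition primitives :: "nat set \<Rightarrow> nat set" where
  "primitives S = (THE G. minimal_generating_set G S)"

definition frobenius_number :: "nat set \<Rightarrow> int" where
  "frobenius_number S = (if S = UNIV then -1 else int (Max (- S)))"

definition A :: "nat \<Rightarrow> nat" where
  "A n = (if n = 0 then 0
          else card {S. numerical_semigroup S \<and> Max (primitives S) = n})"

definition N :: "nat \<Rightarrow> nat" where
  "N n = (if n = 0 then 0
          else card {S. numerical_semigroup S \<and> frobenius_number S = int n})"

(* The class n^{o(1)}. Positivity for large n, implicit in taking the logarithm, has to be
   required because ln is total in HOL. As ln n is nonzero for n > 1, the library's
   little-o coincides with the limit of the quotient being 0.

   How the class is used: for f(n) = n^{o(1)} 2^{n/4} an exact identity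
   f(n) = C(n) 2^{n/4} with C in the class cannot hold for f = N - A on all n, since
   N(p) - A(p) = 1 for every prime p (in general N(n) is the sum of A(d) over d dividing n).
   The estimate is therefore read in the one-sided sense of O-notation,
   |f(n)| <= C(n) 2^{n/4} with integer-valued C in the class, for all n, and as an exact
   identity, necessarily with real-valued C, on the even n. *)
definition n_pow_o1 :: "(nat \<Rightarrow> real) \<Rightarrow> bool" where
  "n_pow_o1 C \<longleftrightarrow>
     eventually (\<lambda>n. C n > 0) sequentially \<and> (\<lambda>n. ln (C n)) \<in> o(\<lambda>n. ln (real n))"


(* Primitives are well defined and finite, and the sets counted by A and N are finite,
   so that THE, Max and card above have their intended meaning. *)

lemma submonoid_hull: "submonoid (submonoid hull G)"
  by (rule hull_in) (auto simp: submonoid_def)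

definition atoms :: "nat set \<Rightarrow> nat set" where
  "atoms S = {x \<in> S. x \<noteq> 0 \<and> (\<forall>a\<in>S. \<forall>b\<in>S. x = a + b \<longrightarrow> a = 0 \<or> b = 0)}"

lemma hull_atoms:
  assumes "submonoid S"
  shows "submonoid hull (atoms S) = S"
proof
  show "submonoid hull (atoms S) \<subseteq> S"
    by (rule hull_minimal) (use assms in \<open>auto simp: atoms_def\<close>)
  have "x \<in> S \<longrightarrow> x \<in> submonoid hull (atoms S)" for x
  proof (induction x rule: less_induct)
    case (less x)
    show ?case
    proof
      assume x: "x \<in> S"
      consider "x = 0" | "x \<in> atoms S"
        | a b where "a \<in> S" "b \<in> S" "x = a + b" "a \<noteq> 0" "b \<noteq> 0"
        using x by (auto simp: atoms_def)
      then show "x \<in> submonoid hull (atoms S)"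
      proof cases
        case 1
        then show ?thesis using submonoid_hull[of "atoms S"] by (simp add: submonoid_def)
      next
        case 2
        then show ?thesis by (rule hull_inc)
      next
        case 3
        then have "a \<in> submonoid hull (atoms S)" "b \<in> submonoid hull (atoms S)"
          using less.IH[of a] less.IH[of b] by auto
        then show ?thesis
          using submonoid_hull[of "atoms S"] 3(3) by (simp add: submonoid_def)
      qed
    qed
  qed
  then show "S \<subseteq> submonoid hull (atoms S)" by blast
qed

lemma atoms_subset_generators:
  assumes "submonoid hull G = S"
  shows "atoms S \<subseteq> G"
proof
  fix x assume x: "x \<in> atoms S"
  show "x \<in> G"
  proof (rule ccontr)
    assume "x \<notin> G"
    have S: "submonoid S" using submonoid_hull[of G] assms by simp
    have "submonoid (S - {x})"
      unfolding submonoid_def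
    proof (intro conjI ballI)
      show "0 \<in> S - {x}" using S x by (simp add: submonoid_def atoms_def)
    next
      fix a b assume ab: "a \<in> S - {x}" "b \<in> S - {x}"
      have "a + b \<noteq> x"
      proof
        assume "a + b = x"
        then have "a = 0 \<or> b = 0" using x ab unfolding atoms_def by blast
        then show False using \<open>a + b = x\<close> ab by auto
      qed
      then show "a + b \<in> S - {x}" using S ab by (simp add: submonoid_def)
    qed
    moreover have "G \<subseteq> S - {x}"
      using \<open>x \<notin> G\<close> hull_subset[of G submonoid] assms by auto
    ultimately have "submonoid hull G \<subseteq> S - {x}" by (intro hull_minimal)
    then show False using assms x by (auto simp: atoms_def)
  qed
qed

lemma minimal_generating_set_iff_atoms:
  assumes "submonoid S"
  shows "minimal_generating_set G S \<longleftrightarrow> G = atoms S"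
proof
  assume G: "minimal_generating_set G S"
  then have "atoms S \<subseteq> G"
    by (intro atoms_subset_generators) (simp add: minimal_generating_set_def)
  moreover have "\<not> atoms S \<subset> G"
    using G hull_atoms[OF assms] by (auto simp: minimal_generating_set_def)
  ultimately show "G = atoms S" by blast
next
  assume G: "G = atoms S"
  have "submonoid hull H \<noteq> S" if "H \<subset> atoms S" for H
    using that atoms_subset_generators[of H S] by blast
  then show "minimal_generating_set G S"
    using G hull_atoms[OF assms] by (simp add: minimal_generating_set_def)
qed

lemma ex1_minimal_generating_set:
  "numerical_semigroup S \<Longrightarrow> \<exists>!G. minimal_generating_set G S"
  by (simp add: minimal_generating_set_iff_atoms numerical_semigroup_def)

lemma primitives_eq_atoms: "numerical_semigroup S \<Longrightarrow> primitives S = atoms S"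
  by (simp add: primitives_def minimal_generating_set_iff_atoms numerical_semigroup_def)

lemma finite_primitives:
  assumes "numerical_semigroup S"
  shows "finite (primitives S)"
proof -
  obtain c where c: "\<And>x. x \<notin> S \<Longrightarrow> x < c"
    using assms unfolding numerical_semigroup_def finite_nat_set_iff_bounded by auto
  have "atoms S \<subseteq> {..2 * c + 1}"
  proof
    fix x assume x: "x \<in> atoms S"
    show "x \<in> {..2 * c + 1}"
    proof (rule ccontr)
      assume "x \<notin> {..2 * c + 1}"
      then have x_eq: "x = (c + 1) + (x - (c + 1))" and gt: "c < x - (c + 1)" by auto
      have irred: "a = 0 \<or> b = 0" if "a \<in> S" "b \<in> S" "x = a + b" for a b
        using x that by (auto simp: atoms_def)
      have "c + 1 \<in> S" using c[of "c + 1"] by auto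
      moreover have "x - (c + 1) \<in> S" using c[of "x - (c + 1)"] gt by (meson not_less_iff_gr_or_eq)
      ultimately have "c + 1 = 0 \<or> x - (c + 1) = 0" using x_eq by (rule irred)
      then show False using gt by simp
    qed
  qed
  then have "finite (atoms S)" by (rule finite_subset) simp
  then show ?thesis using assms by (simp add: primitives_eq_atoms)
qed

lemma finite_max_primitive_eq:
  "finite {S. numerical_semigroup S \<and> Max (primitives S) = n}"
proof (rule finite_subset)
  show "{S. numerical_semigroup S \<and> Max (primitives S) = n} \<subseteq> (hull) submonoid ` Pow {..n}"
  proof
    fix S assume "S \<in> {S. numerical_semigroup S \<and> Max (primitives S) = n}"
    then have S: "numerical_semigroup S" "Max (primitives S) = n" by auto
    have "primitives S \<subseteq> {..n}" using S finite_primitives by auto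
    moreover have "S = submonoid hull (primitives S)"
      unfolding primitives_eq_atoms[OF S(1)]
      using S(1) by (intro hull_atoms[symmetric]) (simp add: numerical_semigroup_def)
    ultimately show "S \<in> (hull) submonoid ` Pow {..n}" by blast
  qed
qed simp

lemma finite_frobenius_number_eq:
  "finite {S. numerical_semigroup S \<and> frobenius_number S = int n}"
proof (rule finite_subset)
  show "{S. numerical_semigroup S \<and> frobenius_number S = int n} \<subseteq> uminus ` Pow {..n}"
  proof
    fix S assume "S \<in> {S. numerical_semigroup S \<and> frobenius_number S = int n}"
    then have "finite (- S)" "Max (- S) = n"
      by (auto simp: numerical_semigroup_def frobenius_number_def split: if_splits)
    then have "- S \<subseteq> {..n}" by auto
    then show "S \<in> uminus ` Pow {..n}" by (metis PowI double_complement imageI)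
  qed
qed simp

end

theory Submission
  imports Defs "HOL-Real_Asymp.Real_Asymp" "HOL-Library.FuncSet" "HOL-Analysis.Summation_Tests"
begin

text \<open>
  Cutting a semigroup with Frobenius number n, or with largest primitive n, down to the open
  interval from 0 to n gives the same kind of set T: closed under sums below n, with no two
  elements summing to n. All such T come from Frobenius number n; those coming from largest
  primitive n are the ones for which n and the elements of T have greatest common divisor 1.
  Hence N(n) - A(n) counts the remaining T, which are multiples of such sets for proper divisors
  of n. So N(n) - A(n) is at most the sum of N(d) over d \<le> n/2, and at least N(n/2) for even n.
  Since trivially N(F) \<ge> 2^((F-1) div 2), everything reduces to Backelin's bound N(F) = O(2^(F/2)).

  For that bound fix the multiplicity m and write F = qm + r. The Kunz coordinates satisfy
  k(i+j) \<le> k(i) + k(j), so k(i) + k(j) is at least q + 1 if i + j = r, and at least q if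
  i + j = r + m. Counting these pairs independently gives about 2^(F/2) for each m. To sum over m,
  a further saving is needed. If q \<ge> 4, the pair count has a factor 13/16 to spare for each pair
  (and much more for q \<ge> 7). If q is 2 or 3, take a window of indices: either no i in it has
  k(i) = 1, which leaves 6 of 8 possibilities for each pair, or some j in it has k(j) = 1, so that
  k(i+j) \<le> k(i) + 1 links pairs and leaves 53 of 64 possibilities for two linked pairs.
\<close>

subsection \<open>Truncations of numerical semigroups\<close>

text \<open>One condition serves two purposes: \<open>a + b \<noteq> n\<close> holds when n is
  missing from the semigroup, and also when n is a primitive of it.\<close>

definition trunc :: "nat \<Rightarrow> nat set set" where
  "trunc n = {T. T \<subseteq> {0<..<n} \<and> (\<forall>a\<in>T. \<forall>b\<in>T. a + b \<noteq> n \<and> (a + b < n \<longrightarrow> a + b \<in> T))}"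

lemma frobenius_number_eq_iff:
  "numerical_semigroup S \<and> frobenius_number S = int n \<longleftrightarrow> submonoid S \<and> n \<notin> S \<and> {n<..} \<subseteq> S"
proof
  assume S: "numerical_semigroup S \<and> frobenius_number S = int n"
  then have fin: "finite (- S)" and "S \<noteq> UNIV" and Max: "Max (- S) = n" and "submonoid S"
    by (auto simp: numerical_semigroup_def frobenius_number_def split: if_splits)
  then have "Max (- S) \<in> - S" by (intro Max_in) auto
  moreover have "x \<in> S" if "x > n" for x
    using Max_ge[OF fin, of x] Max that by (metis ComplI leD)
  ultimately show "submonoid S \<and> n \<notin> S \<and> {n<..} \<subseteq> S"
    using \<open>submonoid S\<close> Max by auto
next
  assume S: "submonoid S \<and> n \<notin> S \<and> {n<..} \<subseteq> S"
  then have sub: "- S \<subseteq> {..n}" by (auto simp: not_less[symmetric])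
  then have fin: "finite (- S)" by (rule finite_subset) simp
  moreover have "Max (- S) = n" using S sub fin by (intro Max_eqI) auto
  ultimately show "numerical_semigroup S \<and> frobenius_number S = int n"
    using S by (auto simp: numerical_semigroup_def frobenius_number_def)
qed

lemma finite_trunc: "finite (trunc n)"
  by (rule finite_subset[of _ "Pow {0<..<n}"]) (auto simp: trunc_def)

lemma bij_betw_frobenius_trunc:
  assumes "n > 0"
  shows "bij_betw (\<lambda>S. S \<inter> {0<..<n}) {S. submonoid S \<and> n \<notin> S \<and> {n<..} \<subseteq> S} (trunc n)"
proof (rule bij_betw_byWitness[where f' = "\<lambda>T. T \<union> {0} \<union> {n<..}"])
  show "\<forall>S\<in>{S. submonoid S \<and> n \<notin> S \<and> {n<..} \<subseteq> S}. S \<inter> {0<..<n} \<union> {0} \<union> {n<..} = S"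
  proof clarify
    fix S assume S: "submonoid S" "n \<notin> S" "{n<..} \<subseteq> S"
    have "x \<in> S \<inter> {0<..<n} \<union> {0} \<union> {n<..} \<longleftrightarrow> x \<in> S" for x
      using S by (cases x n rule: linorder_cases) (auto simp: submonoid_def)
    then show "S \<inter> {0<..<n} \<union> {0} \<union> {n<..} = S" by blast
  qed
  show "\<forall>T\<in>trunc n. (T \<union> {0} \<union> {n<..}) \<inter> {0<..<n} = T"
    by (auto simp: trunc_def)
  show "(\<lambda>S. S \<inter> {0<..<n}) ` {S. submonoid S \<and> n \<notin> S \<and> {n<..} \<subseteq> S} \<subseteq> trunc n"
    by (auto simp: trunc_def submonoid_def)
  show "(\<lambda>T. T \<union> {0} \<union> {n<..}) ` trunc n \<subseteq> {S. submonoid S \<and> n \<notin> S \<and> {n<..} \<subseteq> S}"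
  proof clarify
    fix T assume T: "T \<in> trunc n"
    have "a + b \<in> T \<union> {0} \<union> {n<..}" if "a \<in> T \<union> {0} \<union> {n<..}" "b \<in> T \<union> {0} \<union> {n<..}" for a b
      using that T by (cases "a + b" n rule: linorder_cases) (auto simp: trunc_def)
    moreover have "n \<notin> T" using T by (auto simp: trunc_def)
    ultimately show "submonoid (T \<union> {0} \<union> {n<..}) \<and> n \<notin> T \<union> {0} \<union> {n<..} \<and> {n<..} \<subseteq> T \<union> {0} \<union> {n<..}"
      using assms unfolding submonoid_def by auto
  qed
qed

lemma N_eq_card_trunc: "n > 0 \<Longrightarrow> N n = card (trunc n)"
  using bij_betw_same_card[OF bij_betw_frobenius_trunc] by (simp add: N_def frobenius_number_eq_iff)

section \<open>Cofinite submonoids and greatest common divisors\<close>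

lemma submonoid_mult: "submonoid S \<Longrightarrow> a \<in> S \<Longrightarrow> k * a \<in> S"
  by (induction k) (auto simp: submonoid_def)

text \<open>If x = b * u + v with v < b and x \<ge> b * b, then v \<le> u and x = v * (b + 1) + (u -
  v) * b.\<close>

lemma cofinite_if_consecutive:
  assumes S: "submonoid S" and b: "b \<in> S" "Suc b \<in> S"
  shows "finite (- S)"
proof (rule finite_subset)
  show "- S \<subseteq> {..<b * b}"
  proof
    fix x assume x: "x \<in> - S"
    have "x \<in> S" if "b * b \<le> x"
    proof -
      have le: "x mod b \<le> x div b"
      proof (cases "b = 0")
        case True
        then have "x * 1 \<in> S" using submonoid_mult[OF S, of 1 x] b by simp
        then show ?thesis using x by simp
      next
        case False
        then have "x mod b < b" "b \<le> x div b"
          using that by (simp_all add: less_eq_div_iff_mult_less_eq)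
        then show ?thesis by simp
      qed
      have "x = b * (x div b) + x mod b" by simp
      also have "\<dots> = b * (x div b - x mod b + x mod b) + x mod b" using le by simp
      also have "\<dots> = (x mod b) * Suc b + (x div b - x mod b) * b" by (simp only: distrib_left) simp
      finally have "x = (x mod b) * Suc b + (x div b - x mod b) * b" .
      moreover have "(x mod b) * Suc b \<in> S" "(x div b - x mod b) * b \<in> S"
        using submonoid_mult[OF S] b by blast+
      ultimately show ?thesis using S unfolding submonoid_def by metis
    qed
    then show "x \<in> {..<b * b}" using x by (metis ComplD leI lessThan_iff)
  qed
qed simp

text \<open>The least positive difference of two elements divides every element.\<close>
lemma cofinite_if_Gcd_1:
  assumes S: "submonoid S" and Gcd: "Gcd S = 1"
  shows "finite (- S)"
proof -
  define P where "P d \<longleftrightarrow> d > 0 \<and> (\<exists>b\<in>S. b + d \<in> S)" for d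
  define d where "d = (LEAST d. P d)"
  have "\<exists>s\<in>S. s > 0"
  proof (rule ccontr)
    assume "\<not> ?thesis"
    then have "S \<subseteq> {0}" by auto
    then show False using Gcd by (metis Gcd_0_iff zero_neq_one)
  qed
  then obtain s where "s \<in> S" "s > 0" by auto
  then have "P s" using S by (auto simp: P_def submonoid_def intro!: bexI[of _ 0])
  then have Pd: "P d" unfolding d_def by (rule LeastI)
  then obtain b where b: "b \<in> S" "b + d \<in> S" "d > 0" by (auto simp: P_def)
  have "d dvd s" if s: "s \<in> S" for s
  proof (rule ccontr)
    assume "\<not> d dvd s"
    then have r: "s mod d > 0" by (auto simp: dvd_eq_mod_eq_0)
    \<comment> \<open>Taking \<open>s div d\<close> copies of b + d, or as many copies of b together
      with s, gives two elements at distance \<open>s mod d\<close>, against the minimality of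
      d.\<close>
    have "(s div d) * (b + d) \<in> S" "(s div d) * b + s \<in> S"
      using submonoid_mult[OF S] b s S by (auto simp: submonoid_def)
    moreover have "(s div d) * (b + d) + s mod d = (s div d) * b + s"
      by (simp add: distrib_left)
    ultimately have "P (s mod d)" using r unfolding P_def by metis
    then have "d \<le> s mod d" unfolding d_def by (rule Least_le)
    then show False using mod_less_divisor[OF \<open>d > 0\<close>, of s] by linarith
  qed
  then have "d dvd Gcd S" by (rule Gcd_greatest)
  then have "d = 1" using Gcd by simp
  then show ?thesis using cofinite_if_consecutive[OF S b(1)] b(2) by simp
qed

lemma Gcd_hull: "Gcd (submonoid hull G) = Gcd G"
proof (rule dvd_antisym)
  show "Gcd (submonoid hull G) dvd Gcd G"
    by (rule Gcd_greatest) (auto intro: Gcd_dvd hull_inc)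
  have "submonoid hull G \<subseteq> {x. Gcd G dvd x}"
    by (rule hull_minimal) (auto simp: submonoid_def)
  then show "Gcd G dvd Gcd (submonoid hull G)" by (intro Gcd_greatest) auto
qed

lemma Gcd_cofinite:
  assumes "finite (- S)" shows "Gcd S = (1 :: nat)"
proof -
  obtain c where c: "\<And>x. x \<notin> S \<Longrightarrow> x < c"
    using assms unfolding finite_nat_set_iff_bounded by auto
  then have "c \<in> S" "Suc c \<in> S" by (metis less_irrefl, metis Suc_lessD less_irrefl)
  then have "Gcd S dvd c" "Gcd S dvd Suc c" by (auto intro: Gcd_dvd)
  then show ?thesis by (metis dvd_diff_nat diff_Suc_1' nat_dvd_1_iff_1 plus_1_eq_Suc diff_add_inverse2)
qed

section \<open>Semigroups with a given largest primitive\<close>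

lemma hull_insert_trunc:
  assumes T: "T \<in> trunc n"
  shows "submonoid hull (insert n T) \<subseteq> {0} \<union> T \<union> {n..}"
proof (rule hull_minimal)
  \<comment> \<open>A sum that does not reach n stays within 0 and T. So n and T generate nothing
    new below n, and T can be read off again.\<close>
  have "a + b \<in> {0} \<union> T \<union> {n..}" if "a \<in> {0} \<union> T \<union> {n..}" "b \<in> {0} \<union> T \<union> {n..}" for a b
    using that T by (cases "a + b < n") (auto simp: trunc_def)
  then show "submonoid ({0} \<union> T \<union> {n..})" unfolding submonoid_def by auto
qed auto

text \<open>The inverse is generation by n and T. A semigroup whose primitives are at most n is
  generated by its elements up to n, and gcd 1 is exactly what makes the generated submonoid
  cofinite.\<close>

lemma bij_betw_max_primitive_trunc:
  assumes "n > 0"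
  shows "bij_betw (\<lambda>S. S \<inter> {0<..<n}) {S. numerical_semigroup S \<and> Max (primitives S) = n}
           {T \<in> trunc n. Gcd (insert n T) = 1}"
proof (rule bij_betw_byWitness[where f' = "\<lambda>T. submonoid hull (insert n T)"])
  have recover: "submonoid hull (insert n (S \<inter> {0<..<n})) = S \<and> n \<in> atoms S"
    if S: "numerical_semigroup S" "Max (primitives S) = n" for S
  proof -
    have sub: "submonoid S" and fin: "finite (atoms S)" and Max: "Max (atoms S) = n"
      using S finite_primitives[OF S(1)] by (auto simp: numerical_semigroup_def primitives_eq_atoms)
    \<comment> \<open>\<open>Max\<close> says nothing about the empty set. Without primitives S
      would be contained in {0}, which is not cofinite.\<close>
    have "atoms S \<noteq> {}"
    proof
      assume "atoms S = {}"
      moreover have "submonoid hull {} \<subseteq> {0}" by (rule hull_minimal) (auto simp: submonoid_def)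
      ultimately have "S \<subseteq> {0}" using hull_atoms[OF sub] by simp
      then have "finite S" by (rule finite_subset) simp
      then have "finite (S \<union> - S)" using S by (simp add: numerical_semigroup_def)
      then show False by simp
    qed
    then have n: "n \<in> atoms S" using Max fin Max_in by blast
    have "atoms S \<subseteq> insert n (S \<inter> {0<..<n})"
    proof
      fix x assume x: "x \<in> atoms S"
      then have "x \<le> n" using Max fin by auto
      then show "x \<in> insert n (S \<inter> {0<..<n})" using x by (auto simp: atoms_def)
    qed
    then have "S \<subseteq> submonoid hull (insert n (S \<inter> {0<..<n}))"
      using hull_mono[of "atoms S" _ submonoid] hull_atoms[OF sub] by metis
    moreover have "submonoid hull (insert n (S \<inter> {0<..<n})) \<subseteq> S"
      using n sub by (intro hull_minimal) (auto simp: atoms_def)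
    ultimately show ?thesis using n by blast
  qed
  then show "\<forall>S\<in>{S. numerical_semigroup S \<and> Max (primitives S) = n}.
      submonoid hull (insert n (S \<inter> {0<..<n})) = S" by blast
  show trunc: "\<forall>T\<in>{T \<in> trunc n. Gcd (insert n T) = 1}. submonoid hull (insert n T) \<inter> {0<..<n} = T"
  proof clarify
    fix T assume "T \<in> trunc n"
    then have "T \<subseteq> {0<..<n}" by (simp add: trunc_def)
    moreover have "T \<subseteq> submonoid hull (insert n T)" by (auto intro: hull_inc)
    ultimately show "submonoid hull (insert n T) \<inter> {0<..<n} = T"
      using hull_insert_trunc[OF \<open>T \<in> trunc n\<close>] by auto
  qed
  show "(\<lambda>S. S \<inter> {0<..<n}) ` {S. numerical_semigroup S \<and> Max (primitives S) = n}
      \<subseteq> {T \<in> trunc n. Gcd (insert n T) = 1}"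
  proof clarify
    fix S assume S: "numerical_semigroup S" "n = Max (primitives S)"
    then have rec: "submonoid hull (insert n (S \<inter> {0<..<n})) = S" "n \<in> atoms S"
      using recover by auto
    have "Gcd (insert n (S \<inter> {0<..<n})) = 1"
      using rec(1) Gcd_hull[of "insert n (S \<inter> {0<..<n})"] Gcd_cofinite[of S] S(1)
      by (simp add: numerical_semigroup_def)
    moreover have "S \<inter> {0<..<n} \<in> trunc n"
      using S(1) rec(2) by (fastforce simp: trunc_def numerical_semigroup_def submonoid_def atoms_def)
    ultimately show "S \<inter> {0<..<Max (primitives S)} \<in> trunc (Max (primitives S)) \<and>
        Gcd (insert (Max (primitives S)) (S \<inter> {0<..<Max (primitives S)})) = 1"
      using S(2) by simp
  qed
  show "(\<lambda>T. submonoid hull (insert n T)) ` {T \<in> trunc n. Gcd (insert n T) = 1}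
      \<subseteq> {S. numerical_semigroup S \<and> Max (primitives S) = n}"
  proof clarify
    fix T assume T: "T \<in> trunc n" "Gcd (insert n T) = 1"
    define S where "S = submonoid hull (insert n T)"
    have sub: "submonoid S" unfolding S_def by (rule submonoid_hull)
    have ns: "numerical_semigroup S"
      using sub cofinite_if_Gcd_1[OF sub] T(2) Gcd_hull[of "insert n T"]
      by (simp add: numerical_semigroup_def S_def)
    have S_le: "S \<inter> {0<..<n} = T" using trunc T by (auto simp: S_def)
    have "n \<in> atoms S"
    proof -
      have "n \<in> S" unfolding S_def by (rule hull_inc) simp
      moreover have "a = 0 \<or> b = 0" if "a \<in> S" "b \<in> S" "n = a + b" for a b
      proof (rule ccontr)
        assume "\<not> ?thesis"
        then have "a \<in> T" "b \<in> T" using that S_le by auto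
        then show False using T(1) that(3) by (auto simp: trunc_def)
      qed
      ultimately show ?thesis using assms by (auto simp: atoms_def)
    qed
    moreover have "atoms S \<subseteq> insert n T"
      by (rule atoms_subset_generators) (simp add: S_def)
    then have "\<forall>x\<in>atoms S. x \<le> n" using T(1) by (auto simp: trunc_def)
    ultimately have "Max (primitives S) = n"
      using finite_primitives[OF ns] primitives_eq_atoms[OF ns] by (intro Max_eqI) auto
    then show "numerical_semigroup (submonoid hull insert n T) \<and>
        Max (primitives (submonoid hull insert n T)) = n"
      using ns by (simp add: S_def)
  qed
qed

section \<open>The difference of the two counts\<close>

definition imprimitive_trunc :: "nat \<Rightarrow> nat set set" where
  "imprimitive_trunc n = {T \<in> trunc n. Gcd (insert n T) \<noteq> 1}"

lemma N_eq_A_plus: "n > 0 \<Longrightarrow> N n = A n + card (imprimitive_trunc n)"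
proof -
  assume n: "n > 0"
  have "trunc n = {T \<in> trunc n. Gcd (insert n T) = 1} \<union> imprimitive_trunc n"
    by (auto simp: imprimitive_trunc_def)
  moreover have "card ({T \<in> trunc n. Gcd (insert n T) = 1} \<union> imprimitive_trunc n) =
      card {T \<in> trunc n. Gcd (insert n T) = 1} + card (imprimitive_trunc n)"
    using finite_trunc[of n] by (intro card_Un_disjoint) (auto simp: imprimitive_trunc_def)
  moreover have "A n = card {T \<in> trunc n. Gcd (insert n T) = 1}"
    using bij_betw_same_card[OF bij_betw_max_primitive_trunc[OF n]] n by (simp add: A_def)
  ultimately show ?thesis using N_eq_card_trunc[OF n] by simp
qed

lemma scale_in_trunc_iff:
  assumes "g > 0"
  shows "(*) g ` T \<in> trunc (g * d) \<longleftrightarrow> T \<in> trunc d"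
proof -
  have "g * a + g * b = g * c \<longleftrightarrow> a + b = c" "g * a + g * b < g * c \<longleftrightarrow> a + b < c" for a b c
    using assms by (simp_all flip: distrib_left)
  moreover have "g * a + g * b \<in> (*) g ` T \<longleftrightarrow> a + b \<in> T" for a b
    using assms by (auto simp flip: distrib_left)
  ultimately show ?thesis using assms by (auto simp: trunc_def subset_iff)
qed

text \<open>Dividing n and T by their gcd g \<ge> 2 gives a member of \<open>trunc d\<close> with d
  = n / g \<le> n / 2, and T is recovered from it by scaling with \<open>n div d\<close>. The d that
  do not divide n only enlarge the bound.\<close>

lemma card_imprimitive_trunc_le:
  assumes n: "n > 0"
  shows "card (imprimitive_trunc n) \<le> (\<Sum>d\<in>{1..n div 2}. card (trunc d))"
proof -
  have "imprimitive_trunc n \<subseteq> (\<Union>d\<in>{1..n div 2}. (`) ((*) (n div d)) ` trunc d)"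
  proof
    fix T assume T: "T \<in> imprimitive_trunc n"
    define g where "g = Gcd (insert n T)"
    have dvd: "g dvd x" if "x \<in> insert n T" for x unfolding g_def using that by (rule Gcd_dvd)
    then obtain d where d: "n = g * d" by blast
    have "g \<noteq> 1" using T by (simp add: imprimitive_trunc_def g_def del: Gcd_insert)
    moreover have "g > 0" "d > 0" using n unfolding d by simp_all
    ultimately have g: "g > 0" "d > 0" "g \<ge> 2" by simp_all
    then have "2 * d \<le> n" unfolding d by (intro mult_right_mono) simp_all
    have im: "T = (*) g ` ((\<lambda>x. x div g) ` T)" using dvd by (simp add: image_image)
    have "(*) g ` (\<lambda>x. x div g) ` T \<in> trunc (g * d)"
      using T d im by (simp add: imprimitive_trunc_def del: Gcd_insert)
    then have "(\<lambda>x. x div g) ` T \<in> trunc d"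
      by (simp only: scale_in_trunc_iff[OF g(1)])
    moreover have "n div d = g" using d g by simp
    ultimately have "T \<in> (`) ((*) (n div d)) ` trunc d" using im by (metis imageI)
    then show "T \<in> (\<Union>d\<in>{1..n div 2}. (`) ((*) (n div d)) ` trunc d)"
      using \<open>2 * d \<le> n\<close> g by (intro UN_I[of d]) auto
  qed
  then have "card (imprimitive_trunc n) \<le> card (\<Union>d\<in>{1..n div 2}. (`) ((*) (n div d)) ` trunc d)"
    using finite_trunc by (intro card_mono) auto
  also have "\<dots> \<le> (\<Sum>d\<in>{1..n div 2}. card ((`) ((*) (n div d)) ` trunc d))"
    by (rule card_UN_le) simp
  also have "\<dots> \<le> (\<Sum>d\<in>{1..n div 2}. card (trunc d))"
    using finite_trunc by (intro sum_mono card_image_le)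
  finally show ?thesis .
qed

lemma card_imprimitive_trunc_ge:
  assumes m: "m > 0"
  shows "card (trunc m) \<le> card (imprimitive_trunc (2 * m))"
proof (rule card_inj_on_le[where f = "(`) ((*) 2)"])
  show "inj_on ((`) ((*) (2::nat))) (trunc m)"
    by (rule inj_on_subset[OF inj_on_image]) (auto simp: inj_on_def)
  show "(`) ((*) 2) ` trunc m \<subseteq> imprimitive_trunc (2 * m)"
  proof clarify
    fix T assume "T \<in> trunc m"
    then have "(*) 2 ` T \<in> trunc (2 * m)" using scale_in_trunc_iff[of 2 T m] by simp
    moreover have "2 dvd Gcd (insert (2 * m) ((*) 2 ` T))" by (rule Gcd_greatest) auto
    ultimately show "(*) 2 ` T \<in> imprimitive_trunc (2 * m)"
      by (auto simp: imprimitive_trunc_def simp del: Gcd_insert)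
  qed
  show "finite (imprimitive_trunc (2 * m))" using finite_trunc by (simp add: imprimitive_trunc_def)
qed

text \<open>Two elements above m / 2 have sum above m, so every subset of
  \<open>{m div 2<..<m}\<close> is a truncation.\<close>

lemma card_trunc_ge:
  "2 ^ ((m - 1) div 2) \<le> card (trunc m)"
proof -
  have "a + b > m" if "m div 2 < a" "m div 2 < b" for a b using that by linarith
  then have big: "a + b > m" if "X \<subseteq> {m div 2<..<m}" "a \<in> X" "b \<in> X" for X a b
    using that by (meson greaterThanLessThan_iff subsetD)
  have "Pow {m div 2<..<m} \<subseteq> trunc m"
  proof
    fix X assume X: "X \<in> Pow {m div 2<..<m}"
    then have "X \<subseteq> {0<..<m}" by auto
    moreover have "a + b \<noteq> m \<and> (a + b < m \<longrightarrow> a + b \<in> X)" if "a \<in> X" "b \<in> X" for a b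
      using big[of X a b] X that by auto
    ultimately show "X \<in> trunc m" unfolding trunc_def by blast
  qed
  then have "card (Pow {m div 2<..<m}) \<le> card (trunc m)" using finite_trunc card_mono by blast
  moreover have "m - Suc (m div 2) = (m - 1) div 2" by presburger
  ultimately show ?thesis by (simp add: card_Pow)
qed

subsection \<open>Symmetric functions\<close>

text \<open>The indices in I label blocks of coordinates, \<open>\<phi> g i\<close> reads block i,
  and \<open>D i\<close> contains its possible values. If the blocks together determine g, they may
  be counted independently.\<close>

lemma card_le_prod_blocks:
  assumes I: "finite I" and D: "\<And>i. i \<in> I \<Longrightarrow> finite (D i)"
    and mem: "\<And>g i. g \<in> X \<Longrightarrow> i \<in> I \<Longrightarrow> \<phi> g i \<in> D i"
    and inj: "\<And>g g'. g \<in> X \<Longrightarrow> g' \<in> X \<Longrightarrow> (\<And>i. i \<in> I \<Longrightarrow> \<phi> g i = \<phi> g' i) \<Longrightarrow> g = g'"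
  shows "card X \<le> (\<Prod>i\<in>I. card (D i))"
proof -
  have "card X \<le> card (PiE I D)"
  proof (rule card_inj_on_le[where f = "\<lambda>g. restrict (\<phi> g) I"])
    show "inj_on (\<lambda>g. restrict (\<phi> g) I) X"
      by (rule inj_onI) (metis inj restrict_apply')
    show "(\<lambda>g. restrict (\<phi> g) I) ` X \<subseteq> PiE I D" using mem by auto
    show "finite (PiE I D)" using I D by (intro finite_PiE) auto
  qed
  then show ?thesis by (simp add: card_PiE I)
qed

text \<open>This models the Kunz coordinates on either side of r: below r with n = r and L = q + 1,
  above r with n = m - r and L = q, the index then being shifted by r.\<close>

definition sym_fun :: "nat \<Rightarrow> nat \<Rightarrow> (nat \<Rightarrow> nat) set" where
  "sym_fun n L = {g \<in> {1..<n} \<rightarrow>\<^sub>E {1..L}. \<forall>i\<in>{1..<n}. L \<le> g i + g (n - i)}"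

definition heavy_pairs :: "nat \<Rightarrow> (nat \<times> nat) set" where
  "heavy_pairs L = {(x, y) \<in> {1..L} \<times> {1..L}. L \<le> x + y}"

text \<open>The value at the fixed point of the reflection \<open>i \<mapsto> n - i\<close>, with junk value 1 for odd n.\<close>
definition mid_value :: "nat \<Rightarrow> (nat \<Rightarrow> nat) \<Rightarrow> nat" where
  "mid_value n g = (if even n then g (n div 2) else 1)"

lemma finite_heavy_pairs: "finite (heavy_pairs L)"
  by (rule finite_subset[of _ "{1..L} \<times> {1..L}"]) (auto simp: heavy_pairs_def)

lemma finite_sym_fun: "finite (sym_fun n L)"
  by (rule finite_subset[of _ "{1..<n} \<rightarrow>\<^sub>E {1..L}"]) (auto simp: sym_fun_def intro!: finite_PiE)

lemma mid_value_mem: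
  assumes "g \<in> sym_fun n L" "n > 0" "L > 0"
  shows "mid_value n g \<in> {1..L}"
proof (cases "even n")
  case True
  then have "n div 2 \<in> {1..<n}" using assms(2) by auto
  then have "g (n div 2) \<in> {1..L}" using assms(1) unfolding sym_fun_def by blast
  then show ?thesis using True by (simp add: mid_value_def)
qed (use assms(3) in \<open>simp add: mid_value_def\<close>)

lemma heavy_pairs_mem:
  assumes "g \<in> sym_fun n L" "1 \<le> i" "i \<le> (n - 1) div 2"
  shows "(g i, g (n - i)) \<in> heavy_pairs L"
proof -
  have "i \<in> {1..<n}" "n - i \<in> {1..<n}" using assms(2,3) by auto
  then have "g i \<in> {1..L}" "g (n - i) \<in> {1..L}" "L \<le> g i + g (n - i)"
    using assms(1) unfolding sym_fun_def by blast+
  then show ?thesis by (simp add: heavy_pairs_def)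
qed

lemma sym_fun_eqI:
  assumes "g \<in> sym_fun n L" "g' \<in> sym_fun n L" "mid_value n g = mid_value n g'"
    and "\<And>i. 1 \<le> i \<Longrightarrow> i \<le> (n - 1) div 2 \<Longrightarrow> g i = g' i \<and> g (n - i) = g' (n - i)"
  shows "g = g'"
proof (rule PiE_ext)
  show "g \<in> {1..<n} \<rightarrow>\<^sub>E {1..L}" "g' \<in> {1..<n} \<rightarrow>\<^sub>E {1..L}"
    using assms(1,2) by (simp_all add: sym_fun_def)
  fix i assume i: "i \<in> {1..<n}"
  then have "i \<le> (n - 1) div 2 \<or> n - i \<le> (n - 1) div 2 \<or> (even n \<and> i = n div 2)"
    unfolding atLeastLessThan_iff by presburger
  then consider "i \<le> (n - 1) div 2" | "n - i \<le> (n - 1) div 2" | "even n" "i = n div 2" by blast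
  then show "g i = g' i"
  proof cases
    case 2
    then have "g (n - (n - i)) = g' (n - (n - i))" using i by (intro assms(4)[THEN conjunct2]) auto
    then show ?thesis using i by simp
  qed (use assms(3,4) i in \<open>auto simp: mid_value_def\<close>)
qed

text \<open>There is one block for each reflected pair and one for the middle value, which causes
  the factor L.\<close>

lemma card_sym_fun_restricted_le:
  assumes X: "X \<subseteq> sym_fun n L" and n: "n > 0" and L: "L > 0"
    and P: "\<And>i. i \<in> {1..(n - 1) div 2} \<Longrightarrow> P i \<subseteq> heavy_pairs L"
    and mem: "\<And>g i. g \<in> X \<Longrightarrow> i \<in> {1..(n - 1) div 2} \<Longrightarrow> (g i, g (n - i)) \<in> P i"
  shows "card X \<le> L * (\<Prod>i\<in>{1..(n - 1) div 2}. card (P i))"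
proof -
  define h where "h = (n - 1) div 2"
  \<comment> \<open>Index 0 is free for the middle value, padded to a pair by the constant
    1.\<close>
  define D where "D i = (if i = 0 then (\<lambda>x. (x, 1)) ` {1..L} else P i)" for i
  define \<phi> where "\<phi> g i = (if i = 0 then (mid_value n g, 1) else (g i, g (n - i)))" for g and i :: nat
  have "card X \<le> (\<Prod>i\<in>{0..h}. card (D i))"
  proof (rule card_le_prod_blocks[where \<phi> = \<phi>])
    show "finite (D i)" if "i \<in> {0..h}" for i
      using that P[of i] finite_subset[OF _ finite_heavy_pairs] by (auto simp: D_def h_def)
    show "\<phi> g i \<in> D i" if "g \<in> X" "i \<in> {0..h}" for g i
      using mem[of g i] mid_value_mem[of g n L] that X n L by (auto simp: \<phi>_def D_def h_def)
    show "g = g'" if "g \<in> X" "g' \<in> X" and eq: "\<And>i. i \<in> {0..h} \<Longrightarrow> \<phi> g i = \<phi> g' i" for g g'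
    proof (rule sym_fun_eqI[of g n L g'])
      show "mid_value n g = mid_value n g'" using eq[of 0] by (simp add: \<phi>_def)
      show "g i = g' i \<and> g (n - i) = g' (n - i)" if "1 \<le> i" "i \<le> (n - 1) div 2" for i
        using eq[of i] that by (simp add: \<phi>_def h_def)
    qed (use that X in auto)
  qed simp
  also have "\<dots> = card (D 0) * (\<Prod>i\<in>{1..h}. card (D i))"
    by (simp add: prod.atLeast_Suc_atMost)
  also have "card (D 0) = L" by (simp add: D_def card_image inj_on_def)
  also have "(\<Prod>i\<in>{1..h}. card (D i)) = (\<Prod>i\<in>{1..h}. card (P i))"
    by (intro prod.cong) (auto simp: D_def)
  finally show ?thesis by (simp add: h_def)
qed

lemma card_sym_fun_le:
  assumes "n > 0" "L > 0"
  shows "card (sym_fun n L) \<le> L * card (heavy_pairs L) ^ ((n - 1) div 2)"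
  using card_sym_fun_restricted_le[of "sym_fun n L" n L "\<lambda>_. heavy_pairs L"] heavy_pairs_mem assms
  by simp

section \<open>Sizes of the pair sets\<close>

lemma heavy_pairs_code:
  "heavy_pairs L = set (filter (\<lambda>(x, y). L \<le> x + y) (List.product [1..<Suc L] [1..<Suc L]))"
  by (auto simp: heavy_pairs_def)

text \<open>In general the size is L^2 - (L - 1) * (L - 2) / 2. It equals 2^L for L = 2 and L = 3,
  which leaves nothing to spare, and is at most 13/16 of 2^L for L from 4 to 7.\<close>

lemma card_heavy_pairs:
  "card (heavy_pairs 2) = 4" "card (heavy_pairs 3) = 8" "card (heavy_pairs 4) = 13"
  "card (heavy_pairs 5) = 19" "card (heavy_pairs 6) = 26" "card (heavy_pairs 7) = 34"
  unfolding heavy_pairs_code by code_simp+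

lemma card_heavy_pairs_3_no_1:
  "card {(x, y) \<in> heavy_pairs 3. x \<noteq> 1} = 6"
proof -
  have "{(x, y) \<in> heavy_pairs 3. x \<noteq> 1} =
      set (filter (\<lambda>(x, y). 3 \<le> x + y \<and> x \<noteq> 1) (List.product [1..<Suc 3] [1..<Suc 3]))"
    by (auto simp: heavy_pairs_def)
  also have "card \<dots> = 6" by code_simp
  finally show ?thesis .
qed

text \<open>The pairs are the values at i, \<open>n - i\<close> and at \<open>i + j\<close>,
  \<open>n - (i + j)\<close>. The inequality \<open>g (i + j) \<le> g i + 1\<close> gives the first
  condition when used at i, and the second when used at \<open>n - (i + j)\<close>, whose shift by j
  is \<open>n - i\<close>.\<close>

definition linked_pairs :: "((nat \<times> nat) \<times> (nat \<times> nat)) set" where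
  "linked_pairs = {((x, y), (u, v)) \<in> heavy_pairs 3 \<times> heavy_pairs 3. u \<le> x + 1 \<and> y \<le> v + 1}"

lemma card_linked_pairs: "card linked_pairs = 53"
proof -
  have "linked_pairs = set (filter (\<lambda>((x, y), (u, v)). u \<le> x + 1 \<and> y \<le> v + 1)
      (let ps = filter (\<lambda>(x, y). 3 \<le> x + y) (List.product [1..<Suc 3] [1..<Suc 3]) in List.product ps ps))"
    unfolding Let_def by (auto simp: heavy_pairs_code linked_pairs_def)
  also have "card \<dots> = 53" by code_simp
  finally show ?thesis .
qed

text \<open>The window lies in the lower half, so its indices belong to different pairs, each of
  which has 6 values left instead of 8.\<close>

lemma card_sym_fun_avoid_1_le:
  assumes n: "n > 0" and u: "u > 0" "u + J \<le> Suc ((n - 1) div 2)"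
  shows "card {g \<in> sym_fun n 3. \<forall>i\<in>{u..<u + J}. g i \<noteq> 1} \<le> 3 * (8 ^ ((n - 1) div 2 - J) * 6 ^ J)"
proof -
  define h where "h = (n - 1) div 2"
  define P where "P i = (if i \<in> {u..<u + J} then {(x, y) \<in> heavy_pairs 3. x \<noteq> 1} else heavy_pairs 3)" for i
  have "card {g \<in> sym_fun n 3. \<forall>i\<in>{u..<u + J}. g i \<noteq> 1} \<le> 3 * (\<Prod>i\<in>{1..h}. card (P i))"
    unfolding h_def
  proof (rule card_sym_fun_restricted_le[OF _ n])
    show "(g i, g (n - i)) \<in> P i"
      if "g \<in> {g \<in> sym_fun n 3. \<forall>i\<in>{u..<u + J}. g i \<noteq> 1}" "i \<in> {1..(n - 1) div 2}" for g i
      using that heavy_pairs_mem[of g n 3 i] by (auto simp: P_def)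
  qed (auto simp: P_def)
  also have "(\<Prod>i\<in>{1..h}. card (P i)) = (\<Prod>i\<in>{1..h}. if i \<in> {u..<u + J} then 6 else 8)"
    using card_heavy_pairs_3_no_1 by (intro prod.cong) (simp_all add: P_def card_heavy_pairs)
  also have "\<dots> = (\<Prod>i\<in>{1..h} \<inter> {u..<u + J}. 6) * (\<Prod>i\<in>{1..h} \<inter> - {u..<u + J}. 8)"
    by (subst prod.If_cases) (simp_all add: Int_def)
  also have "{1..h} \<inter> {u..<u + J} = {u..<u + J}" using u by (auto simp: h_def)
  also have "card ({1..h} \<inter> - {u..<u + J}) = h - J"
  proof -
    have "card ({1..h} - {u..<u + J}) = card {1..h} - card {u..<u + J}"
      using u by (intro card_Diff_subset) (auto simp: h_def)
    then show ?thesis by (simp add: Diff_eq)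
  qed
  then have "(\<Prod>i\<in>{1..h} \<inter> - {u..<u + J}. 8) = (8::nat) ^ (h - J)" by simp
  finally show ?thesis by (simp add: h_def mult.commute)
qed

text \<open>For i up to J the pairs at i and at \<open>i + j\<close> are counted together, with 53
  values instead of 64. \<open>J \<le> j\<close> keeps the two ranges of indices disjoint, and
  \<open>J + j \<le> (n - 1) div 2\<close> keeps both in the lower half.\<close>

lemma card_sym_fun_linked_le:
  assumes n: "n > 0" and j: "J \<le> j" "J + j \<le> (n - 1) div 2"
  shows "card {g \<in> sym_fun n 3. \<forall>i. 1 \<le> i \<longrightarrow> i + j < n \<longrightarrow> g (i + j) \<le> g i + 1}
    \<le> 3 * (8 ^ ((n - 1) div 2 - 2 * J) * 53 ^ J)" (is "card ?X \<le> _")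
proof -
  define h where "h = (n - 1) div 2"
  \<comment> \<open>Each \<open>i \<le> J\<close> labels the pair at i together with the pair at \<open>i + j\<close>, B the other pairs, 0 the middle.\<close>
  define B where "B = {1..h} - {1..J} - {j + 1..j + J}"
  define D where "D i = (if i = 0 then (\<lambda>x. [(x, 1)]) ` {1..3}
    else if i \<le> J then (\<lambda>(p, q). [p, q]) ` linked_pairs else (\<lambda>p. [p]) ` heavy_pairs 3)" for i
  define \<phi> where "\<phi> g i = (if i = 0 then [(mid_value n g, 1)]
    else if i \<le> J then [(g i, g (n - i)), (g (i + j), g (n - (i + j)))] else [(g i, g (n - i))])"
    for g and i :: nat
  have fin: "finite linked_pairs"
    by (rule finite_subset[of _ "heavy_pairs 3 \<times> heavy_pairs 3"])
      (auto simp: linked_pairs_def finite_heavy_pairs)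
  have "card ?X \<le> (\<Prod>i\<in>{0} \<union> {1..J} \<union> B. card (D i))"
  proof (rule card_le_prod_blocks[where \<phi> = \<phi>])
    show "finite (D i)" for i using fin finite_heavy_pairs by (simp add: D_def)
    show "\<phi> g i \<in> D i" if g: "g \<in> ?X" and i: "i \<in> {0} \<union> {1..J} \<union> B" for g i
    proof -
      consider "i = 0" | "1 \<le> i" "i \<le> J" | "J < i" "i \<in> {1..h}" using i by (auto simp: B_def)
      then show ?thesis
      proof cases
        case 1
        then show ?thesis using mid_value_mem[of g n 3] g n by (simp add: \<phi>_def D_def)
      next
        case 2
        then have "(g i, g (n - i)) \<in> heavy_pairs 3" "(g (i + j), g (n - (i + j))) \<in> heavy_pairs 3"
          using g j by (auto intro!: heavy_pairs_mem)
        moreover have "g (i + j) \<le> g i + 1" using g 2 j by auto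
        moreover have "1 \<le> n - (i + j)" "n - (i + j) + j < n" using 2 j n by linarith+
        then have "g (n - (i + j) + j) \<le> g (n - (i + j)) + 1" using g by blast
        moreover have "n - (i + j) + j = n - i" using 2 j by linarith
        ultimately have "((g i, g (n - i)), (g (i + j), g (n - (i + j)))) \<in> linked_pairs"
          by (simp add: linked_pairs_def)
        then show ?thesis using 2 by (auto simp: \<phi>_def D_def image_iff intro: bexI[rotated])
      next
        case 3
        then have "(g i, g (n - i)) \<in> heavy_pairs 3" using g by (auto intro!: heavy_pairs_mem simp: h_def)
        then show ?thesis using 3 by (simp add: \<phi>_def D_def)
      qed
    qed
    show "g = g'" if g: "g \<in> ?X" "g' \<in> ?X"
      and eq: "\<And>i. i \<in> {0} \<union> {1..J} \<union> B \<Longrightarrow> \<phi> g i = \<phi> g' i" for g g'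
    proof (rule sym_fun_eqI[of g n 3 g'])
      show "mid_value n g = mid_value n g'" using eq[of 0] by (simp add: \<phi>_def)
      show "g i = g' i \<and> g (n - i) = g' (n - i)" if i: "1 \<le> i" "i \<le> (n - 1) div 2" for i
      proof -
        consider "i \<le> J" | "i \<in> B" "J < i" | "j + 1 \<le> i" "i \<le> j + J"
          using i by (fastforce simp: B_def h_def)
        then show ?thesis
        proof cases
          case 1
          then show ?thesis using eq[of i] i by (simp add: \<phi>_def)
        next
          case 2
          then show ?thesis using eq[of i] i by (simp add: \<phi>_def)
        next
          case 3
          then obtain k where "i = k + j" "1 \<le> k" "k \<le> J"
            by (intro that[of "i - j"]) linarith+
          then show ?thesis using eq[of k] by (simp add: \<phi>_def)
        qed
      qed
    qed (use g in auto)
  qed (simp add: B_def)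
  also have "\<dots> = card (D 0) * (\<Prod>i\<in>{1..J}. card (D i)) * (\<Prod>i\<in>B. card (D i))"
    by (subst prod.union_disjoint; (subst prod.union_disjoint)?) (auto simp: B_def)
  also have "card (D 0) = 3" by (simp add: D_def card_image inj_on_def)
  also have "card ((\<lambda>(p, q). [p, q]) ` linked_pairs) = 53"
    by (subst card_image) (auto simp: inj_on_def card_linked_pairs)
  then have "(\<Prod>i\<in>{1..J}. card (D i)) = (\<Prod>i\<in>{1..J}. 53)"
    by (intro prod.cong) (simp_all add: D_def)
  also have "(\<Prod>i\<in>B. card (D i)) = (\<Prod>i\<in>B. 8)"
    by (intro prod.cong) (auto simp: D_def B_def card_image inj_on_def card_heavy_pairs)
  also have "card B = h - 2 * J"
  proof -
    have "card B = card ({1..h} - ({1..J} \<union> {j + 1..j + J}))" by (simp add: B_def Diff_Un Diff_eq Int_assoc)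
    also have "\<dots> = h - card ({1..J} \<union> {j + 1..j + J})"
      using j by (subst card_Diff_subset) (auto simp: h_def)
    also have "card ({1..J} \<union> {j + 1..j + J}) = J + J"
      using j by (subst card_Un_disjoint) auto
    finally show ?thesis by simp
  qed
  then have "(\<Prod>i\<in>B. 8) = (8::nat) ^ (h - 2 * J)" by simp
  finally show ?thesis by (simp add: h_def mult.commute)
qed

subsection \<open>Kunz coordinates\<close>

definition semigroups_frob_mult :: "nat \<Rightarrow> nat \<Rightarrow> nat set set" where
  "semigroups_frob_mult F m =
    {S. submonoid S \<and> F \<notin> S \<and> {F<..} \<subseteq> S \<and> m \<in> S \<and> (\<forall>x\<in>S. 0 < x \<longrightarrow> m \<le> x)}"

text \<open>Arguments are not restricted to residues below m, so subadditivity needs no correction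
  when i + j exceeds m: passing from i to i + m lowers a positive value by 1.\<close>

definition kunz :: "nat \<Rightarrow> nat set \<Rightarrow> nat \<Rightarrow> nat" where
  "kunz m S i = (LEAST t. i + m * t \<in> S)"

text \<open>Only multiplicities up to F / 2 are treated here, which makes q at least 2; larger ones
  are counted by \<open>card_big_mult_le\<close>.\<close>

locale frob_mult =
  fixes F m q r :: nat
  assumes m_pos: "0 < m" and m_le: "2 * m \<le> F" and q_def: "q = F div m" and r_def: "r = F mod m"
begin

lemma F_eq: "F = m * q + r"
  by (simp add: q_def r_def)

lemma r_less: "r < m"
  using m_pos by (simp add: r_def)

lemma q_ge: "2 \<le> q"
  using m_pos m_le by (simp add: q_def less_eq_div_iff_mult_less_eq)

context
  fixes S assumes S: "S \<in> semigroups_frob_mult F m"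
begin

lemma sub: "submonoid S" and F_notin: "F \<notin> S" and above_F: "x > F \<Longrightarrow> x \<in> S"
  and m_in: "m \<in> S" and m_least: "x \<in> S \<Longrightarrow> 0 < x \<Longrightarrow> m \<le> x"
  using S by (auto simp: semigroups_frob_mult_def)

lemma add_in: "a \<in> S \<Longrightarrow> b \<in> S \<Longrightarrow> a + b \<in> S"
  using sub by (simp add: submonoid_def)

text \<open>S is closed under adding m, so the t with \<open>i + m * t \<in> S\<close> form an
  upward closed set; it is nonempty because everything above F is in S.\<close>

lemma kunz_le_iff: "kunz m S i \<le> t \<longleftrightarrow> i + m * t \<in> S"
proof
  have "F < m * Suc F" using m_pos by (cases m) simp_all
  then have "i + m * Suc F \<in> S" by (intro above_F trans_less_add2)
  then have min: "i + m * kunz m S i \<in> S" unfolding kunz_def by (rule LeastI)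
  assume "kunz m S i \<le> t"
  then obtain d where "t = kunz m S i + d" using le_Suc_ex by blast
  then have "i + m * t = (i + m * kunz m S i) + d * m" by (simp add: algebra_simps)
  then show "i + m * t \<in> S" using add_in[OF min submonoid_mult[OF sub m_in]] by metis
qed (simp add: kunz_def Least_le)

lemma kunz_add: "kunz m S (i + j) \<le> kunz m S i + kunz m S j"
proof -
  have "i + m * kunz m S i \<in> S" "j + m * kunz m S j \<in> S" using kunz_le_iff by blast+
  then have "(i + m * kunz m S i) + (j + m * kunz m S j) \<in> S" by (rule add_in)
  then show ?thesis unfolding kunz_le_iff by (simp add: algebra_simps)
qed

lemma kunz_0: "kunz m S 0 = 0"
  using kunz_le_iff[of 0 0] sub by (simp add: submonoid_def)

lemma kunz_pos: "0 < i \<Longrightarrow> i < m \<Longrightarrow> 1 \<le> kunz m S i"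
  using kunz_le_iff[of i 0] m_least[of i] by (cases "kunz m S i = 0") auto

lemma kunz_le_Suc_q: "kunz m S i \<le> Suc q"
  using above_F[of "i + m * Suc q"] F_eq r_less by (simp add: kunz_le_iff)

lemma kunz_le_q: "r < i \<Longrightarrow> kunz m S i \<le> q"
  using above_F[of "i + m * q"] F_eq by (simp add: kunz_le_iff)

lemma kunz_r: "kunz m S r = Suc q"
  using kunz_le_Suc_q[of r] kunz_le_iff[of r q] F_notin F_eq by (simp add: add.commute)

lemma r_pos: "0 < r"
  using kunz_r kunz_0 by (cases "r = 0") auto

lemma kunz_sym_low: "i \<le> r \<Longrightarrow> Suc q \<le> kunz m S i + kunz m S (r - i)"
  using kunz_add[of i "r - i"] kunz_r by simp

text \<open>Here \<open>r + m = F - m * (q - 1)\<close> is not in S, so that its Kunz coordinate is at least q.\<close>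
lemma kunz_sym_high:
  assumes "i \<le> m - r" shows "q \<le> kunz m S (r + i) + kunz m S (r + (m - r - i))"
proof -
  have "\<not> kunz m S (r + m) < q"
  proof
    assume "kunz m S (r + m) < q"
    then have "kunz m S (r + m) \<le> q - 1" by simp
    then have "r + m + m * (q - 1) \<in> S" by (simp only: kunz_le_iff)
    moreover have "r + m + m * (q - 1) = F" 
      using q_ge F_eq by (cases q) simp_all
    ultimately show False using F_notin by simp
  qed
  moreover have "(r + i) + (r + (m - r - i)) = r + m" using assms r_less by simp
  ultimately show ?thesis using kunz_add[of "r + i" "r + (m - r - i)"] by simp
qed

lemma low_in_sym_fun: "restrict (kunz m S) {1..<r} \<in> sym_fun r (Suc q)"
  using kunz_pos kunz_le_Suc_q kunz_sym_low r_less by (auto simp: sym_fun_def)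

lemma high_in_sym_fun: "(\<lambda>i\<in>{1..<m - r}. kunz m S (r + i)) \<in> sym_fun (m - r) q"
  using kunz_pos kunz_le_q kunz_sym_high r_less by (auto simp: sym_fun_def)

lemma mem_iff: "x \<in> S \<longleftrightarrow> kunz m S (x mod m) \<le> x div m"
  unfolding kunz_le_iff by (simp add: add.commute)

end

lemma inj_kunz:
  assumes S: "S \<in> semigroups_frob_mult F m" "S' \<in> semigroups_frob_mult F m"
    and low: "restrict (kunz m S) {1..<r} = restrict (kunz m S') {1..<r}"
    and high: "(\<lambda>i\<in>{1..<m - r}. kunz m S (r + i)) = (\<lambda>i\<in>{1..<m - r}. kunz m S' (r + i))"
  shows "S = S'"
proof -
  have eq: "kunz m S i = kunz m S' i" if "i < m" for i
  proof -
    consider "i = 0" | "i = r" | "i \<in> {1..<r}" | "r < i" 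
      by (cases "i = 0"; cases i r rule: linorder_cases) auto
    then show ?thesis
    proof cases
      case 3
      then show ?thesis using fun_cong[OF low, of i] by simp
    next
      case 4
      then have "i - r \<in> {1..<m - r}" using that by auto
      then show ?thesis using fun_cong[OF high, of "i - r"] 4 by simp
    qed (simp_all add: kunz_0 kunz_r S)
  qed
  show ?thesis
    using eq m_pos by (auto simp: mem_iff[OF S(1)] mem_iff[OF S(2)])
qed

text \<open>X and Y may be smaller than the full sets of symmetric functions, so a saving on one
  side can be combined with the plain bound on the other.\<close>

lemma card_le_mult:
  assumes low: "(\<lambda>S. restrict (kunz m S) {1..<r}) ` semigroups_frob_mult F m \<subseteq> X" "finite X"
    and high: "(\<lambda>S. \<lambda>i\<in>{1..<m - r}. kunz m S (r + i)) ` semigroups_frob_mult F m \<subseteq> Y" "finite Y"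
  shows "card (semigroups_frob_mult F m) \<le> card X * card Y"
proof -
  have "card (semigroups_frob_mult F m) \<le> card (X \<times> Y)"
  proof (rule card_inj_on_le[where
        f = "\<lambda>S. (restrict (kunz m S) {1..<r}, \<lambda>i\<in>{1..<m - r}. kunz m S (r + i))"])
    show "inj_on (\<lambda>S. (restrict (kunz m S) {1..<r}, \<lambda>i\<in>{1..<m - r}. kunz m S (r + i)))
        (semigroups_frob_mult F m)"
      by (rule inj_onI) (metis inj_kunz prod.inject)
  qed (use assms in auto)
  then show ?thesis by (simp add: card_cartesian_product)
qed

lemma low_image: "(\<lambda>S. restrict (kunz m S) {1..<r}) ` semigroups_frob_mult F m \<subseteq> sym_fun r (Suc q)"
  using low_in_sym_fun by blast

lemma high_image:
  "(\<lambda>S. \<lambda>i\<in>{1..<m - r}. kunz m S (r + i)) ` semigroups_frob_mult F m \<subseteq> sym_fun (m - r) q"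
  using high_in_sym_fun by blast

end

subsection \<open>Semigroups of a given Frobenius number and multiplicity\<close>

text \<open>This is a union bound over the functions avoiding 1 in the window and, for each of J
  values of j, those linked by j. The offset d serves the upper side, where index i stands for the
  residue r + i, so that the window of residues from J to 2 * J is shifted down by r.\<close>

lemma card_sym_fun_dichotomy_le:
  assumes n: "n > 0" and J: "6 * J \<le> n - 1" "J = 0 \<or> d < J" and X: "X \<subseteq> sym_fun n 3"
    and dich: "\<And>g. g \<in> X \<Longrightarrow> (\<forall>i\<in>{J - d..<J - d + J}. g i \<noteq> 1) \<or>
      (\<exists>j\<in>{J..<2 * J}. \<forall>i. 1 \<le> i \<longrightarrow> i + j < n \<longrightarrow> g (i + j) \<le> g i + 1)"
  shows "real (card X) \<le> 3 * 8 ^ ((n - 1) div 2) * ((1 + real J) * (53/64) ^ J)"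
proof (cases "J = 0")
  case True
  have "card X \<le> card (sym_fun n 3)" by (rule card_mono[OF finite_sym_fun X])
  also have "\<dots> \<le> 3 * 8 ^ ((n - 1) div 2)" using card_sym_fun_le[of n 3] n by (simp add: card_heavy_pairs)
  finally have "real (card X) \<le> real (3 * 8 ^ ((n - 1) div 2))" by (rule of_nat_mono)
  then show ?thesis using True by simp
next
  case False
  define h where "h = (n - 1) div 2"
  have h: "3 * J \<le> h" using J by (simp add: h_def)
  define U where "U = {g \<in> sym_fun n 3. \<forall>i\<in>{J - d..<J - d + J}. g i \<noteq> 1}"
  define V where "V j = {g \<in> sym_fun n 3. \<forall>i. 1 \<le> i \<longrightarrow> i + j < n \<longrightarrow> g (i + j) \<le> g i + 1}" for j
  have fin: "finite U" "finite (V j)" for j using finite_sym_fun by (simp_all add: U_def V_def)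
  have "X \<subseteq> U \<union> (\<Union>j\<in>{J..<2 * J}. V j)"
  proof
    fix g assume g: "g \<in> X"
    with X have "g \<in> sym_fun n 3" by blast
    with dich[OF g] show "g \<in> U \<union> (\<Union>j\<in>{J..<2 * J}. V j)" unfolding U_def V_def by blast
  qed
  then have "card X \<le> card (U \<union> (\<Union>j\<in>{J..<2 * J}. V j))" using fin by (intro card_mono) auto
  also have "\<dots> \<le> card U + card (\<Union>j\<in>{J..<2 * J}. V j)" by (rule card_Un_le)
  also have "card (\<Union>j\<in>{J..<2 * J}. V j) \<le> (\<Sum>j\<in>{J..<2 * J}. card (V j))" by (rule card_UN_le) simp
  also have "(\<Sum>j\<in>{J..<2 * J}. card (V j)) \<le> (\<Sum>j\<in>{J..<2 * J}. 3 * (8 ^ (h - 2 * J) * 53 ^ J))"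
    unfolding V_def h_def using h by (intro sum_mono card_sym_fun_linked_le n) (auto simp: h_def)
  also have "card U \<le> 3 * (8 ^ (h - J) * 6 ^ J)"
    unfolding U_def h_def using h False J by (intro card_sym_fun_avoid_1_le n) (auto simp: h_def)
  finally have "card X \<le> 3 * (8 ^ (h - J) * 6 ^ J) + J * (3 * (8 ^ (h - 2 * J) * 53 ^ J))" by simp
  then have "real (card X) \<le> real (3 * (8 ^ (h - J) * 6 ^ J) + J * (3 * (8 ^ (h - 2 * J) * 53 ^ J)))"
    by (rule of_nat_mono)
  then have "real (card X) \<le> 3 * (8 ^ (h - J) * 6 ^ J) + J * (3 * (8 ^ (h - 2 * J) * 53 ^ J))" by simp
  moreover have "(8::real) ^ (h - J) * 6 ^ J = 8 ^ h * (3/4) ^ J"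
    using h by (simp add: power_diff power_divide flip: power_mult_distrib)
      (simp add: field_simps flip: power_mult_distrib)
  moreover have "(8::real) ^ (h - 2 * J) * 53 ^ J = 8 ^ h * (53/64) ^ J"
    using h by (simp add: power_diff power_divide power_mult)
  ultimately have "real (card X) \<le> 3 * (8 ^ h * (3/4) ^ J) + J * (3 * (8 ^ h * (53/64) ^ J))"
    by simp
  \<comment> \<open>As 3/4 = 48/64, the avoiding case is absorbed into the rate 53/64 of the linked
    case.\<close>
  moreover have "8 ^ h * (3/4::real) ^ J \<le> 8 ^ h * (53/64) ^ J"
    by (intro mult_left_mono power_mono) simp_all
  ultimately have "real (card X) \<le> 3 * (8 ^ h * (53/64) ^ J) + J * (3 * (8 ^ h * (53/64) ^ J))"
    by linarith
  then show ?thesis by (simp add: h_def algebra_simps)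
qed

section \<open>Bounds for each range of q\<close>

lemma card_sym_fun_le_crude: "card (sym_fun n L) \<le> L ^ (n - 1)"
proof -
  have "card (sym_fun n L) \<le> card ({1..<n} \<rightarrow>\<^sub>E {1..L})"
    by (rule card_mono) (auto simp: sym_fun_def intro!: finite_PiE)
  then show ?thesis by (simp add: card_PiE)
qed

text \<open>Equality holds at q = 7. The induction step uses (q + 2) / (q + 1) \<le> 9/8 and (9/8)^7
  \<le> 8.\<close>

lemma Suc_pow_7_le: "7 \<le> q \<Longrightarrow> Suc q ^ 7 \<le> 8 ^ q"
proof (induction q rule: dec_induct)
  case (step q)
  have "8 ^ 7 * Suc (Suc q) ^ 7 = (8 * Suc (Suc q)) ^ 7" by (simp only: power_mult_distrib)
  also have "\<dots> \<le> (9 * Suc q) ^ 7" using step by (intro power_mono) simp_all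
  also have "\<dots> = 9 ^ 7 * Suc q ^ 7" by (simp only: power_mult_distrib)
  also have "\<dots> \<le> (8 ^ 7 * 8) * 8 ^ q" using step by (intro mult_mono) simp_all
  finally show ?case by simp
qed simp

lemma card_heavy_pairs_le:
  assumes "4 \<le> L" "L \<le> 7"
  shows "real (card (heavy_pairs L)) \<le> 13/16 * 2 ^ L"
proof -
  consider "L = 4" | "L = 5" | "L = 6" | "L = 7" using assms by linarith
  then show ?thesis by cases (simp_all add: card_heavy_pairs)
qed

context frob_mult
begin

abbreviation "low_half \<equiv> (r - 1) div 2"
abbreviation "high_half \<equiv> (m - r - 1) div 2"

text \<open>A pair contributing 2^L amounts to 2^(L/2) per coordinate, and
  \<open>Suc q * r + q * (m - r) = F\<close>.\<close>

lemma base_le: "(2 ^ Suc q) ^ low_half * (2 ^ q) ^ high_half \<le> sqrt 2 ^ F"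
proof -
  have "Suc q * (r - 1) + q * (m - r - 1) \<le> Suc q * r + q * (m - r)"
    by (intro add_mono mult_left_mono) simp_all
  also have "\<dots> = F" using F_eq r_less by (simp add: algebra_simps diff_mult_distrib2)
  finally have le_F: "Suc q * (r - 1) + q * (m - r - 1) \<le> F" .
  have "2 * (Suc q * low_half + q * high_half) = Suc q * (2 * low_half) + q * (2 * high_half)"
    by (simp add: algebra_simps)
  also have "\<dots> \<le> Suc q * (r - 1) + q * (m - r - 1)"
    by (intro add_mono mult_left_mono) simp_all
  finally have le: "2 * (Suc q * low_half + q * high_half) \<le> F" using le_F by linarith
  have "(2 ^ Suc q) ^ low_half * (2 ^ q) ^ high_half = (2::real) ^ (Suc q * low_half + q * high_half)"
    by (simp only: power_add power_mult)
  also have "\<dots> = sqrt 2 ^ (2 * (Suc q * low_half + q * high_half))"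
    by (subst power_mult) simp
  also have "\<dots> \<le> sqrt 2 ^ F" using le by (intro power_increasing) simp_all
  finally show ?thesis .
qed

lemma r_pos_if_nonempty: "card (semigroups_frob_mult F m) > 0 \<Longrightarrow> r > 0"
  using r_pos by (metis card_gt_0_iff ex_in_conv)

text \<open>The pair counts 8 = 2^3 and 4 = 2^2 have nothing to spare, so the saving comes from the
  dichotomy on the lower side. It depends on r alone, which is F - 2 * m here, and so can be summed
  over m. The constant 6 is 3 * 2, from the two middle values.\<close>

lemma card_le_if_q_2:
  assumes q: "q = 2"
  shows "real (card (semigroups_frob_mult F m)) \<le>
    6 * ((1 + real ((r - 1) div 6)) * (53/64) ^ ((r - 1) div 6)) * sqrt 2 ^ F"
proof (cases "r > 0")
  case True
  define J where "J = (r - 1) div 6"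
  define \<kappa> where "\<kappa> = ((1 + real J) * (53/64) ^ J)"
  have \<kappa>: "0 \<le> \<kappa>" by (simp add: \<kappa>_def)
  define X where "X = (\<lambda>S. restrict (kunz m S) {1..<r}) ` semigroups_frob_mult F m"
  have X: "X \<subseteq> sym_fun r 3" using low_image q by (simp add: X_def numeral_eq_Suc)
  have J: "6 * J \<le> r - 1" by (simp add: J_def)
  have "real (card X) \<le> 3 * 8 ^ low_half * \<kappa>"
    unfolding \<kappa>_def
  proof (rule card_sym_fun_dichotomy_le[where d = 0, OF True J _ X])
    fix g assume "g \<in> X"
    then obtain S where S: "S \<in> semigroups_frob_mult F m" and g: "g = restrict (kunz m S) {1..<r}"
      by (auto simp: X_def)
    show "(\<forall>i\<in>{J - 0..<J - 0 + J}. g i \<noteq> 1) \<or>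
      (\<exists>j\<in>{J..<2 * J}. \<forall>i. 1 \<le> i \<longrightarrow> i + j < r \<longrightarrow> g (i + j) \<le> g i + 1)"
    proof (cases "\<exists>j\<in>{J..<2 * J}. kunz m S j = 1")
      case True
      then obtain j where j: "j \<in> {J..<2 * J}" "kunz m S j = 1" by blast
      have "g (i + j) \<le> g i + 1" if "1 \<le> i" "i + j < r" for i
        using kunz_add[OF S, of i j] j that by (simp add: g)
      then show ?thesis using j by blast
    next
      case False
      have "g i \<noteq> 1" if "i \<in> {J..<2 * J}" for i
      proof -
        have "i \<in> {1..<r}" using that J by auto
        then show ?thesis using False that by (simp add: g)
      qed
      then show ?thesis by (simp add: mult_2)
    qed
  qed auto
  moreover have "card (sym_fun (m - r) 2) \<le> 2 * 4 ^ high_half"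
    using card_sym_fun_le[of "m - r" 2] r_less by (simp add: card_heavy_pairs)
  then have "real (card (sym_fun (m - r) 2)) \<le> real (2 * 4 ^ high_half)" by (rule of_nat_mono)
  ultimately have "real (card X) * real (card (sym_fun (m - r) 2)) \<le>
      3 * 8 ^ low_half * \<kappa> * real (2 * 4 ^ high_half)"
    using \<kappa> by (intro mult_mono) simp_all
  moreover have "card (semigroups_frob_mult F m) \<le> card X * card (sym_fun (m - r) 2)"
    using high_image q finite_subset[OF X finite_sym_fun] finite_sym_fun
    by (intro card_le_mult) (simp_all add: X_def)
  then have "real (card (semigroups_frob_mult F m)) \<le> real (card X * card (sym_fun (m - r) 2))"
    by (rule of_nat_mono)
  ultimately have "real (card (semigroups_frob_mult F m)) \<le>
      6 * \<kappa> * (8 ^ low_half * 4 ^ high_half)" by (simp add: mult_ac)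
  also have "\<dots> \<le> 6 * \<kappa> * sqrt 2 ^ F"
    using base_le q \<kappa> by (intro mult_left_mono) simp_all
  finally show ?thesis by (simp add: J_def \<kappa>_def)
next
  case False
  then have "card (semigroups_frob_mult F m) = 0" using r_pos_if_nonempty by auto
  then show ?thesis by simp
qed

text \<open>For small r the lower pairs save too little, so the dichotomy is applied above r, and
  the count 13 of lower pairs is relaxed to 16. \<open>r < J\<close> makes the shifted window start
  at a positive index.\<close>

lemma card_le_if_q_3_linked:
  assumes q: "q = 3" and r: "0 < r" and J: "J = (m - r - 1) div 6" "r < J"
  shows "real (card (semigroups_frob_mult F m)) \<le> 12 * ((1 + real J) * (53/64) ^ J) * sqrt 2 ^ F"
proof -
  define \<kappa> where "\<kappa> = ((1 + real J) * (53/64) ^ J)"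
  have \<kappa>: "0 \<le> \<kappa>" by (simp add: \<kappa>_def)
  define Y where "Y = (\<lambda>S. \<lambda>i\<in>{1..<m - r}. kunz m S (r + i)) ` semigroups_frob_mult F m"
  have Y: "Y \<subseteq> sym_fun (m - r) 3" using high_image q by (simp add: Y_def)
  have J6: "6 * J \<le> m - r - 1" by (simp add: J)
  have "real (card Y) \<le> 3 * 8 ^ high_half * \<kappa>"
    unfolding \<kappa>_def
  proof (rule card_sym_fun_dichotomy_le[where d = r, OF _ J6 _ Y])
    fix g assume "g \<in> Y"
    then obtain S where S: "S \<in> semigroups_frob_mult F m"
      and g: "g = (\<lambda>i\<in>{1..<m - r}. kunz m S (r + i))" by (auto simp: Y_def)
    show "(\<forall>i\<in>{J - r..<J - r + J}. g i \<noteq> 1) \<or>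
      (\<exists>j\<in>{J..<2 * J}. \<forall>i. 1 \<le> i \<longrightarrow> i + j < m - r \<longrightarrow> g (i + j) \<le> g i + 1)"
    proof (cases "\<exists>j\<in>{J..<2 * J}. kunz m S j = 1")
      case True
      then obtain j where j: "j \<in> {J..<2 * J}" "kunz m S j = 1" by blast
      \<comment> \<open>Here j is a residue itself while the index i stands for r + i, so adding j
        shifts the upper function by j.\<close>
      have "g (i + j) \<le> g i + 1" if "1 \<le> i" "i + j < m - r" for i
        using kunz_add[OF S, of "r + i" j] j that by (simp add: g add.assoc)
      then show ?thesis using j by blast
    next
      case False
      have "g i \<noteq> 1" if i: "i \<in> {J - r..<J - r + J}" for i
      proof -
        have "i \<in> {1..<m - r}" "r + i \<in> {J..<2 * J}" using i J(2) J6 by auto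
        then show ?thesis using False by (simp add: g)
      qed
      then show ?thesis by blast
    qed
  qed (use J r_less in auto)
  moreover have "card (sym_fun r 4) \<le> 4 * 13 ^ low_half"
    using card_sym_fun_le[of r 4] r by (simp add: card_heavy_pairs)
  then have "card (sym_fun r 4) \<le> 4 * 16 ^ low_half"
    using power_mono[of "13::nat" 16 low_half] by linarith
  then have "real (card (sym_fun r 4)) \<le> real (4 * 16 ^ low_half)" by (rule of_nat_mono)
  ultimately have "real (card (sym_fun r 4)) * real (card Y) \<le>
      real (4 * 16 ^ low_half) * (3 * 8 ^ high_half * \<kappa>)"
    using \<kappa> by (intro mult_mono) simp_all
  moreover have "card (semigroups_frob_mult F m) \<le> card (sym_fun r 4) * card Y"
    using low_image q finite_subset[OF Y finite_sym_fun] finite_sym_fun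
    by (intro card_le_mult) (simp_all add: Y_def)
  then have "real (card (semigroups_frob_mult F m)) \<le> real (card (sym_fun r 4) * card Y)"
    by (rule of_nat_mono)
  ultimately have "real (card (semigroups_frob_mult F m)) \<le>
      12 * \<kappa> * (16 ^ low_half * 8 ^ high_half)" by (simp add: mult_ac)
  also have "\<dots> \<le> 12 * \<kappa> * sqrt 2 ^ F"
    using base_le q \<kappa> by (intro mult_left_mono) simp_all
  finally show ?thesis by (simp only: \<kappa>_def)
qed

text \<open>e counts the pairs with L \<ge> 4, each saving a factor 13/16: for q = 3 the lower pairs
  only, for q \<ge> 4 all pairs. The rate 13/16 = 52/64 is relaxed to 53/64 for uniformity, and 42 =
  7 * 6 bounds the two middle factors.\<close>

lemma card_le_if_no_linking:
  assumes q: "q \<le> 6" and r: "0 < r"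
    and e: "q = 3 \<and> e = low_half \<or> 4 \<le> q \<and> e = low_half + high_half"
  shows "real (card (semigroups_frob_mult F m)) \<le> 42 * (53/64) ^ e * sqrt 2 ^ F"
proof -
  have low: "real (card (heavy_pairs (Suc q)) ^ low_half) \<le> (13/16) ^ low_half * (2 ^ Suc q) ^ low_half"
    using card_heavy_pairs_le[of "Suc q"] q e
    by (simp only: of_nat_power flip: power_mult_distrib) (intro power_mono; auto)
  have high: "real (card (heavy_pairs q) ^ high_half) \<le> (13/16) ^ (e - low_half) * (2 ^ q) ^ high_half"
  proof (cases "q = 3")
    case True
    then show ?thesis using e by (simp add: card_heavy_pairs)
  next
    case False
    then have "e - low_half = high_half" "4 \<le> q" using e by auto
    then show ?thesis
      using card_heavy_pairs_le[of q] q
      by (simp only: of_nat_power flip: power_mult_distrib) (intro power_mono; auto)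
  qed
  have "card (semigroups_frob_mult F m) \<le> card (sym_fun r (Suc q)) * card (sym_fun (m - r) q)"
    by (intro card_le_mult low_image high_image finite_sym_fun)
  also have "\<dots> \<le> (Suc q * card (heavy_pairs (Suc q)) ^ low_half) * (q * card (heavy_pairs q) ^ high_half)"
    using r r_less q_ge by (intro mult_mono card_sym_fun_le) simp_all
  also have "\<dots> = (Suc q * q) * (card (heavy_pairs (Suc q)) ^ low_half * card (heavy_pairs q) ^ high_half)"
    by (simp only: mult_ac)
  also have "\<dots> \<le> (7 * 6) * (card (heavy_pairs (Suc q)) ^ low_half * card (heavy_pairs q) ^ high_half)"
    using q by (intro mult_right_mono mult_mono) simp_all
  finally have "real (card (semigroups_frob_mult F m)) \<le>
      real ((7 * 6) * (card (heavy_pairs (Suc q)) ^ low_half * card (heavy_pairs q) ^ high_half))"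
    by (rule of_nat_mono)
  also have "\<dots> = 42 * (real (card (heavy_pairs (Suc q)) ^ low_half) * real (card (heavy_pairs q) ^ high_half))"
    by simp
  also have "\<dots> \<le> 42 * (((13/16) ^ low_half * (2 ^ Suc q) ^ low_half) *
      ((13/16) ^ (e - low_half) * (2 ^ q) ^ high_half))"
    using low high by (intro mult_left_mono mult_mono) simp_all
  also have "\<dots> = 42 * ((13/16) ^ low_half * (13/16) ^ (e - low_half)) *
      ((2 ^ Suc q) ^ low_half * (2 ^ q) ^ high_half)" by (simp only: mult_ac)
  also have "(13/16::real) ^ low_half * (13/16) ^ (e - low_half) = (13/16) ^ e"
    using e by (simp flip: power_add) auto
  also have "42 * (13/16) ^ e * ((2 ^ Suc q) ^ low_half * (2 ^ q) ^ high_half) \<le>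
      42 * (53/64) ^ e * sqrt 2 ^ F"
    using base_le by (intro mult_mono power_mono) simp_all
  finally show ?thesis .
qed

text \<open>In every case there are e savings with m \<le> 14 * e + 40; as F < 7 * m, this yields e
  \<ge> (F - 280) / 98. The saving is thus exponential in F, so that a sum over m does no
  harm.\<close>

lemma card_le_if_q_mid:
  assumes q: "3 \<le> q" "q \<le> 6"
  shows "real (card (semigroups_frob_mult F m)) \<le>
    42 * (1 + real F) * (53/64) powr ((real F - 280) / 98) * sqrt 2 ^ F"
proof (cases "r > 0")
  case True
  have F: "F < 7 * m"
  proof -
    have "m * q \<le> m * 6" using q by simp
    then show ?thesis using F_eq r_less by linarith
  qed
  have main: ?thesis
    if e: "m \<le> 14 * e + 40" and le: "real (card (semigroups_frob_mult F m)) \<le> 42 * (1 + real F) * (53/64) ^ e * sqrt 2 ^ F" for e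
  proof -
    have "(real F - 280) / 98 \<le> real e" using F e by simp
    then have "(53/64::real) powr real e \<le> (53/64) powr ((real F - 280) / 98)"
      by (intro powr_mono') simp_all
    then have "(53/64::real) ^ e \<le> (53/64) powr ((real F - 280) / 98)" by (simp add: powr_realpow)
    then have "42 * (1 + real F) * (53/64) ^ e * sqrt 2 ^ F \<le>
        42 * (1 + real F) * (53/64) powr ((real F - 280) / 98) * sqrt 2 ^ F"
      by (intro mult_right_mono mult_left_mono) simp_all
    then show ?thesis using le by linarith
  qed
  have weaken: "42 * (53/64) ^ e * sqrt 2 ^ F \<le> 42 * (1 + real F) * (53/64) ^ e * sqrt 2 ^ F" for e
    by (intro mult_right_mono) simp_all
  define J where "J = (m - r - 1) div 6"
  consider "q = 3" "r < J" | "q = 3" "J \<le> r" | "4 \<le> q" using q by linarith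
  then show ?thesis
  proof cases
    case 1
    have "m \<le> 14 * J + 40" using 1(2) by (simp add: J_def)
    moreover have "12 * ((1 + real J) * (53/64) ^ J) * sqrt 2 ^ F \<le> 42 * (1 + real F) * (53/64) ^ J * sqrt 2 ^ F"
    proof -
      have "J \<le> F" using m_le by (simp add: J_def)
      then have "12 * (1 + real J) \<le> 42 * (1 + real F)" by simp
      then show ?thesis unfolding mult.assoc[symmetric] by (intro mult_right_mono) simp_all
    qed
    ultimately show ?thesis
      using main[of J] card_le_if_q_3_linked[OF 1(1) True J_def 1(2)] by linarith
  next
    case 2
    \<comment> \<open>The factor 14 arises here: m is at most 7 * r + 6, and r at most
      \<open>2 * low_half + 2\<close>. The summand 40 is generous.\<close>
    have "m \<le> 14 * low_half + 40" using 2(2) by (simp add: J_def)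
    then show ?thesis
      using main[of low_half] card_le_if_no_linking[of low_half] weaken[of low_half] 2 q True by linarith
  next
    case 3
    have "m \<le> 14 * (low_half + high_half) + 40" by simp
    then show ?thesis
      using main[of "low_half + high_half"] card_le_if_no_linking[of "low_half + high_half"]
        weaken[of "low_half + high_half"] 3 q True by linarith
  qed
next
  case False
  then have "card (semigroups_frob_mult F m) = 0" using r_pos_if_nonempty by auto
  then show ?thesis by simp
qed

text \<open>Symmetry is ignored: each coordinate has at most q + 1 values. Seventh powers give (q +
  1)^(7m) \<le> 8^(qm) \<le> 2^(3F), and 3/7 < 1/2.\<close>

lemma card_le_if_q_large:
  assumes q: "7 \<le> q"
  shows "real (card (semigroups_frob_mult F m)) \<le> 2 powr (3 * real F / 7)"
proof -
  have "card (semigroups_frob_mult F m) \<le> card (sym_fun r (Suc q)) * card (sym_fun (m - r) q)"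
    by (intro card_le_mult low_image high_image finite_sym_fun)
  also have "\<dots> \<le> Suc q ^ (r - 1) * q ^ (m - r - 1)" by (intro mult_mono card_sym_fun_le_crude) simp_all
  also have "\<dots> \<le> Suc q ^ (r - 1) * Suc q ^ (m - r - 1)" by (intro mult_left_mono power_mono) simp_all
  also have "\<dots> = Suc q ^ (r - 1 + (m - r - 1))" by (simp only: power_add)
  also have "\<dots> \<le> Suc q ^ m" using r_less by (intro power_increasing) simp_all
  finally have "card (semigroups_frob_mult F m) ^ 7 \<le> (Suc q ^ m) ^ 7" by (rule power_mono) simp
  also have "\<dots> = (Suc q ^ 7) ^ m" by (simp only: mult.commute flip: power_mult)
  also have "\<dots> \<le> (8 ^ q) ^ m" using Suc_pow_7_le[OF q] by (rule power_mono) simp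
  also have "\<dots> \<le> 8 ^ F" using F_eq by (simp flip: power_mult add: mult.commute)
  finally have "real (card (semigroups_frob_mult F m) ^ 7) \<le> real (8 ^ F)" by (rule of_nat_mono)
  also have "\<dots> = (2 powr (3 * real F / 7)) ^ 7"
  proof -
    have "(2 powr (3 * real F / 7)) ^ 7 = (2::real) powr (real 7 * (3 * real F / 7))"
      by (simp add: powr_power)
    also have "\<dots> = 2 powr real (3 * F)" by simp
    also have "\<dots> = 2 ^ (3 * F)" by (rule powr_realpow) simp
    finally show ?thesis by (simp add: power_mult)
  qed
  finally show ?thesis by (simp add: power_mono_iff)
qed

end

subsection \<open>The number of semigroups of a given Frobenius number\<close>

lemma frobenius_eq_Un:
  "{S. submonoid S \<and> F \<notin> S \<and> {F<..} \<subseteq> S} \<subseteq>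
    {S. submonoid S \<and> F \<notin> S \<and> {F<..} \<subseteq> S \<and> (\<forall>x\<in>S. 0 < x \<longrightarrow> F < 2 * x)} \<union>
    (\<Union>m\<in>{1..F div 2}. semigroups_frob_mult F m)"
proof
  fix S assume S: "S \<in> {S. submonoid S \<and> F \<notin> S \<and> {F<..} \<subseteq> S}"
  define m where "m = (LEAST x. x \<in> S \<and> 0 < x)"
  have "Suc F \<in> S" using S by auto
  then have "\<exists>x. x \<in> S \<and> 0 < x" by blast
  then have m: "m \<in> S \<and> 0 < m" unfolding m_def by (rule LeastI_ex)
  have least: "m \<le> x" if "x \<in> S" "0 < x" for x
    using Least_le[of "\<lambda>x. x \<in> S \<and> 0 < x" x] that by (simp add: m_def)
  have "S \<in> semigroups_frob_mult F m" using S m least by (auto simp: semigroups_frob_mult_def)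
  moreover have "\<forall>x\<in>S. 0 < x \<longrightarrow> F < 2 * x" if "F div 2 < m"
  proof (intro ballI impI)
    fix x assume "x \<in> S" "0 < x"
    then have "m \<le> x" by (rule least)
    then show "F < 2 * x" using that by linarith
  qed
  ultimately show "S \<in> {S. submonoid S \<and> F \<notin> S \<and> {F<..} \<subseteq> S \<and> (\<forall>x\<in>S. 0 < x \<longrightarrow> F < 2 * x)} \<union>
    (\<Union>m\<in>{1..F div 2}. semigroups_frob_mult F m)"
    using S m by (cases "F div 2 < m") auto
qed

text \<open>S is determined by its elements strictly between F / 2 and F.\<close>

lemma card_big_mult_le:
  "card {S. submonoid S \<and> F \<notin> S \<and> {F<..} \<subseteq> S \<and> (\<forall>x\<in>S. 0 < x \<longrightarrow> F < 2 * x)} \<le> 2 ^ (F div 2)"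
    (is "card ?B \<le> _")
proof -
  have "card ?B \<le> card (Pow {F div 2<..<F})"
  proof (rule card_inj_on_le[where f = "\<lambda>S. S \<inter> {F div 2<..<F}"])
    have rec: "x \<in> S \<longleftrightarrow> x = 0 \<or> x \<in> S \<inter> {F div 2<..<F} \<or> F < x" if S: "S \<in> ?B" for x S
    proof
      assume x: "x \<in> S"
      then have "x \<noteq> F" "x = 0 \<or> F < 2 * x" using S by auto
      then have "x = 0 \<or> F div 2 < x \<and> x < F \<or> F < x" by linarith
      with x show "x = 0 \<or> x \<in> S \<inter> {F div 2<..<F} \<or> F < x" by simp
    qed (use S in \<open>auto simp: submonoid_def\<close>)
    show "inj_on (\<lambda>S. S \<inter> {F div 2<..<F}) ?B"
    proof (rule inj_onI)
      fix S S' assume S: "S \<in> ?B" "S' \<in> ?B" and eq: "S \<inter> {F div 2<..<F} = S' \<inter> {F div 2<..<F}"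
      have "x \<in> S \<longleftrightarrow> x \<in> S'" for x
        using rec[OF S(1), of x] rec[OF S(2), of x] unfolding eq by blast
      then show "S = S'" by blast
    qed
  qed auto
  also have "\<dots> = 2 ^ (F - Suc (F div 2))" by (simp add: card_Pow)
  also have "\<dots> \<le> 2 ^ (F div 2)" by (intro power_increasing) presburger+
  finally show ?thesis .
qed

text \<open>The saving of \<open>card_le_if_q_2\<close> at x = r, up to the constant 6. Its sum over
  all x has to converge for the total to stay O(2^(F/2)).\<close>

definition linked_saving :: "nat \<Rightarrow> real" where
  "linked_saving x = (1 + real ((x - 1) div 6)) * (53/64) ^ ((x - 1) div 6)"

text \<open>\<open>(x - 1) div 6\<close> is at least (x - 6) / 6, which gives a real exponent; the
  resulting terms decay exponentially.\<close>

lemma summable_linked_saving: "summable linked_saving"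
proof (rule summable_comparison_test)
  have "norm (linked_saving x) \<le> (1 + real x) * (53/64) powr ((real x - 6) / 6)" for x
  proof -
    have "(53/64::real) ^ ((x - 1) div 6) = (53/64) powr real ((x - 1) div 6)"
      by (simp add: powr_realpow)
    also have "\<dots> \<le> (53/64) powr ((real x - 6) / 6)"
    proof (rule powr_mono')
      have "x \<le> 6 * ((x - 1) div 6) + 6" by linarith
      then have "real x \<le> real (6 * ((x - 1) div 6) + 6)" by (rule of_nat_mono)
      then show "(real x - 6) / 6 \<le> real ((x - 1) div 6)" by simp
    qed simp_all
    finally have "(53/64::real) ^ ((x - 1) div 6) \<le> (53/64) powr ((real x - 6) / 6)" .
    moreover have "real ((x - 1) div 6) \<le> real x" by (rule of_nat_mono) linarith
    ultimately have "linked_saving x \<le> (1 + real x) * (53/64) powr ((real x - 6) / 6)"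
      unfolding linked_saving_def by (intro mult_mono) simp_all
    then show ?thesis by (simp add: linked_saving_def)
  qed
  then show "\<exists>N. \<forall>n\<ge>N. norm (linked_saving n) \<le> (1 + real n) * (53/64) powr ((real n - 6) / 6)" by blast
  show "summable (\<lambda>n. (1 + real n) * (53/64) powr ((real n - 6) / 6))"
  proof (rule summable_comparison_test_bigo)
    show "summable (\<lambda>n. norm (inverse (real n ^ 2)))"
      using inverse_power_summable[of 2, where 'a = real] by simp
    show "(\<lambda>n. (1 + real n) * (53/64) powr ((real n - 6) / 6)) \<in> O(\<lambda>n. inverse (real n ^ 2))"
      by real_asymp
  qed
qed

text \<open>Unlike \<open>linked_saving\<close> this is the same for all m, but it is small enough
  to be multiplied by F.\<close>

definition mid_saving :: "nat \<Rightarrow> real" where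
  "mid_saving F = 42 * (1 + real F) * (53/64) powr ((real F - 280) / 98)"

lemma card_semigroups_frob_mult_le:
  assumes m: "m \<in> {1..F div 2}"
  shows "real (card (semigroups_frob_mult F m)) \<le>
    6 * linked_saving (F - 2 * m) * sqrt 2 ^ F + mid_saving F * sqrt 2 ^ F + 2 powr (3 * real F / 7)"
proof -
  interpret frob_mult F m "F div m" "F mod m"
    using m by unfold_locales auto
  have nonneg: "0 \<le> 6 * linked_saving (F - 2 * m) * sqrt 2 ^ F" "0 \<le> mid_saving F * sqrt 2 ^ F"
    by (simp_all add: linked_saving_def mid_saving_def)
  consider "F div m = 2" | "3 \<le> F div m" "F div m \<le> 6" | "7 \<le> F div m" using q_ge by linarith
  then show ?thesis
  proof cases
    case 1
    then have "F mod m = F - 2 * m" using F_eq by simp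
    then show ?thesis using card_le_if_q_2[OF 1] nonneg by (simp add: linked_saving_def add_increasing2)
  next
    case 2
    then show ?thesis using card_le_if_q_mid nonneg by (simp add: mid_saving_def add_increasing2 add_increasing)
  next
    case 3
    then show ?thesis using card_le_if_q_large nonneg by (simp add: add_increasing)
  qed
qed

lemma sqrt_2_pow: "sqrt 2 ^ n = 2 powr (real n / 2)"
  by (simp add: powr_half_sqrt[symmetric] powr_power)

text \<open>The terms with q = 2 stay below a convergent series because different m give different F
  - 2 * m; those with q > 2 are at most F / 2 times an exponentially small factor.\<close>

lemma card_trunc_le:
  obtains K where "K > 0" "\<And>F. F > 0 \<Longrightarrow> real (card (trunc F)) \<le> K * sqrt 2 ^ F"
proof -
  have "(\<lambda>F. real F * mid_saving F) \<longlonglongrightarrow> 0" unfolding mid_saving_def by real_asymp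
  then have "Bseq (\<lambda>F. real F * mid_saving F)" using convergentI convergent_imp_Bseq by blast
  then obtain K1 where K1: "K1 > 0" "\<And>F. norm (real F * mid_saving F) \<le> K1" by (auto elim: BseqE)
  \<comment> \<open>The 1/14 is 1/2 - 3/7.\<close>
  have "(\<lambda>F. real F * 2 powr (- (real F / 14))) \<longlonglongrightarrow> 0" by real_asymp
  then have "Bseq (\<lambda>F. real F * 2 powr (- (real F / 14)))" using convergentI convergent_imp_Bseq by blast
  then obtain K2 where K2: "K2 > 0" "\<And>F. norm (real F * 2 powr (- (real F / 14))) \<le> K2" by (auto elim: BseqE)
  define K0 where "K0 = suminf linked_saving"
  have K0: "K0 \<ge> 0" unfolding K0_def
    by (rule suminf_nonneg[OF summable_linked_saving]) (simp add: linked_saving_def)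
  show ?thesis
    \<comment> \<open>The summands belong to m > F/2, to q = 2, to q from 3 to 6, and to q > 6.\<close>
  proof (rule that[of "1 + 6 * K0 + K1 + K2"])
    show "1 + 6 * K0 + K1 + K2 > 0" using K0 K1 K2 by simp
    fix F :: nat assume F: "F > 0"
    define B where "B = {S. submonoid S \<and> F \<notin> S \<and> {F<..} \<subseteq> S \<and> (\<forall>x\<in>S. 0 < x \<longrightarrow> F < 2 * x)}"
    have fin: "finite {S. submonoid S \<and> F \<notin> S \<and> {F<..} \<subseteq> S}"
      using bij_betw_finite[OF bij_betw_frobenius_trunc[OF F]] finite_trunc by blast
    have finB: "finite B"
      by (rule finite_subset[OF _ fin]) (auto simp: B_def)
    have finM: "finite (semigroups_frob_mult F m)" for m
      by (rule finite_subset[OF _ fin]) (auto simp: semigroups_frob_mult_def)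
    have "card (trunc F) = card {S. submonoid S \<and> F \<notin> S \<and> {F<..} \<subseteq> S}"
      using bij_betw_same_card[OF bij_betw_frobenius_trunc[OF F]] by simp
    also have "\<dots> \<le> card (B \<union> (\<Union>m\<in>{1..F div 2}. semigroups_frob_mult F m))"
      using frobenius_eq_Un[of F] finB finM by (intro card_mono) (auto simp: B_def)
    also have "\<dots> \<le> card B + card (\<Union>m\<in>{1..F div 2}. semigroups_frob_mult F m)" by (rule card_Un_le)
    also have "\<dots> \<le> 2 ^ (F div 2) + (\<Sum>m\<in>{1..F div 2}. card (semigroups_frob_mult F m))"
      unfolding B_def by (intro add_mono card_big_mult_le card_UN_le) simp
    finally have "real (card (trunc F)) \<le> real (2 ^ (F div 2) + (\<Sum>m\<in>{1..F div 2}. card (semigroups_frob_mult F m)))"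
      by (rule of_nat_mono)
    also have "\<dots> = 2 ^ (F div 2) + (\<Sum>m\<in>{1..F div 2}. real (card (semigroups_frob_mult F m)))" by simp
    also have "(2::real) ^ (F div 2) = sqrt 2 ^ (2 * (F div 2))" by (subst power_mult) simp
    also have "\<dots> \<le> sqrt 2 ^ F" by (rule power_increasing) simp_all
    also have "(\<Sum>m\<in>{1..F div 2}. real (card (semigroups_frob_mult F m))) \<le>
        (\<Sum>m\<in>{1..F div 2}. 6 * linked_saving (F - 2 * m) * sqrt 2 ^ F + mid_saving F * sqrt 2 ^ F
          + 2 powr (3 * real F / 7))"
      by (intro sum_mono card_semigroups_frob_mult_le)
    also have "\<dots> = 6 * (\<Sum>m\<in>{1..F div 2}. linked_saving (F - 2 * m)) * sqrt 2 ^ F +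
        real (F div 2) * (mid_saving F * sqrt 2 ^ F) + real (F div 2) * 2 powr (3 * real F / 7)"
      by (simp add: sum.distrib sum_distrib_left sum_distrib_right)
    also have "(\<Sum>m\<in>{1..F div 2}. linked_saving (F - 2 * m)) \<le> K0"
    proof -
      have inj: "inj_on (\<lambda>m. F - 2 * m) {1..F div 2}" by (rule inj_onI) auto
      have "(\<Sum>m\<in>{1..F div 2}. linked_saving (F - 2 * m)) = sum linked_saving ((\<lambda>m. F - 2 * m) ` {1..F div 2})"
        by (simp only: sum.reindex[OF inj] comp_def)
      also have "\<dots> \<le> K0"
        unfolding K0_def by (intro sum_le_suminf summable_linked_saving) (simp_all add: linked_saving_def)
      finally show ?thesis .
    qed
    also have "real (F div 2) * (mid_saving F * sqrt 2 ^ F) \<le> K1 * sqrt 2 ^ F"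
    proof -
      have "real (F div 2) * mid_saving F \<le> real F * mid_saving F"
        by (intro mult_right_mono) (simp_all add: mid_saving_def)
      also have "\<dots> \<le> K1" using K1(2)[of F] by simp
      finally show ?thesis unfolding mult.assoc[symmetric] by (intro mult_right_mono) simp_all
    qed
    also have "real (F div 2) * 2 powr (3 * real F / 7) \<le> K2 * sqrt 2 ^ F"
    proof -
      have eq: "2 powr (3 * real F / 7) = 2 powr (- (real F / 14)) * sqrt 2 ^ F"
        by (simp add: sqrt_2_pow flip: powr_add)
      have "real (F div 2) * 2 powr (- (real F / 14)) \<le> real F * 2 powr (- (real F / 14))"
        by (intro mult_right_mono) simp_all
      also have "\<dots> \<le> K2" using K2(2)[of F] by simp
      finally show ?thesis unfolding eq mult.assoc[symmetric] by (intro mult_right_mono) simp_all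
    qed
    finally show "real (card (trunc F)) \<le> (1 + 6 * K0 + K1 + K2) * sqrt 2 ^ F"
      by (simp add: algebra_simps)
  qed
qed

section \<open>The estimate for the difference\<close>

lemma sum_sqrt_2_pow_le: "(\<Sum>d\<in>{1..D}. sqrt 2 ^ d) \<le> 4 * sqrt 2 ^ D"
proof (induction D)
  case (Suc D)
  \<comment> \<open>The induction step amounts to 4 + sqrt 2 \<le> 4 * sqrt 2, that is, sqrt 2 \<ge>
    4/3.\<close>
  have "4/3 \<le> sqrt 2" by (rule real_le_rsqrt) (simp add: power2_eq_square)
  then have "4 * sqrt 2 ^ D \<le> 3 * sqrt 2 * sqrt 2 ^ D" by (intro mult_right_mono) simp_all
  moreover have "(\<Sum>d\<in>{1..Suc D}. sqrt 2 ^ d) = (\<Sum>d\<in>{1..D}. sqrt 2 ^ d) + sqrt 2 * sqrt 2 ^ D" by simp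
  ultimately show ?case using Suc unfolding power_Suc by linarith
qed simp

lemma const_in_smallo_ln: "(\<lambda>n. c) \<in> o(\<lambda>n. ln (real n))"
  by real_asymp

theorem theorem1p3:
  "(\<exists>C :: nat \<Rightarrow> nat. n_pow_o1 (\<lambda>n. real (C n)) \<and>
      (\<forall>n. \<bar>real (N n) - real (A n)\<bar> \<le> real (C n) * 2 powr (real n / 4))) \<and>
   (\<exists>C :: nat \<Rightarrow> real. n_pow_o1 C \<and>
      (\<forall>n. even n \<longrightarrow> real (N n) - real (A n) = C n * 2 powr (real n / 4)))"
proof -
  obtain K where K: "K > 0" "\<And>F. F > 0 \<Longrightarrow> real (card (trunc F)) \<le> K * sqrt 2 ^ F"
    using card_trunc_le by blast
  have diff: "real (N n) - real (A n) = real (card (imprimitive_trunc n))" if "n > 0" for n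
    using N_eq_A_plus[OF that] by simp
  have upper: "real (card (imprimitive_trunc n)) \<le> 4 * K * 2 powr (real n / 4)" if "n > 0" for n
  proof -
    have "real (card (imprimitive_trunc n)) \<le> real (\<Sum>d\<in>{1..n div 2}. card (trunc d))"
      using card_imprimitive_trunc_le[OF that] by (rule of_nat_mono)
    also have "\<dots> \<le> (\<Sum>d\<in>{1..n div 2}. K * sqrt 2 ^ d)"
      unfolding of_nat_sum by (intro sum_mono K) simp
    also have "\<dots> = K * (\<Sum>d\<in>{1..n div 2}. sqrt 2 ^ d)" by (simp add: sum_distrib_left)
    also have "\<dots> \<le> K * (4 * sqrt 2 ^ (n div 2))"
      using K(1) sum_sqrt_2_pow_le by (intro mult_left_mono) simp_all
    also have "sqrt 2 ^ (n div 2) \<le> 2 powr (real n / 4)"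
      unfolding sqrt_2_pow by (rule powr_mono) simp_all
    finally show ?thesis using K(1) by (simp add: mult_ac)
  qed
  \<comment> \<open>A constant already suffices; it is rounded up because it has to be a natural
    number.\<close>
  define c where "c = nat \<lceil>4 * K\<rceil>"
  have c: "4 * K \<le> real c" "0 < c" using K(1) unfolding c_def by linarith+
  have "n_pow_o1 (\<lambda>n. real c)" using c const_in_smallo_ln by (simp add: n_pow_o1_def)
  moreover have "\<bar>real (N n) - real (A n)\<bar> \<le> real c * 2 powr (real n / 4)" for n
  proof (cases "n = 0")
    case False
    have "4 * K * 2 powr (real n / 4) \<le> real c * 2 powr (real n / 4)"
      using c by (intro mult_right_mono) simp_all
    then show ?thesis using upper[of n] diff[of n] False by (auto intro: order_trans)
  qed (simp add: N_def A_def)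
  moreover have "\<exists>C :: nat \<Rightarrow> real. n_pow_o1 C \<and>
      (\<forall>n. even n \<longrightarrow> real (N n) - real (A n) = C n * 2 powr (real n / 4))"
  proof (intro exI conjI allI impI)
    \<comment> \<open>At odd n the identity asks for nothing; the value 1 keeps C between the two
      bounds below and accounts for the summand 1 in the upper one.\<close>
    define C where "C n = (if even n then (real (N n) - real (A n)) / 2 powr (real n / 4) else 1)" for n
    have C: "1/2 \<le> C n" "C n \<le> 1 + 4 * K" if n: "n > 0" for n
    proof -
      have "4 * K * 2 powr (real n / 4) \<le> (1 + 4 * K) * 2 powr (real n / 4)"
        by (intro mult_right_mono) simp_all
      then have "real (card (imprimitive_trunc n)) \<le> (1 + 4 * K) * 2 powr (real n / 4)"
        using upper[OF n] by linarith
      then show "C n \<le> 1 + 4 * K" using diff[OF n] K(1) by (simp add: C_def divide_le_eq)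
      show "1/2 \<le> C n"
      proof (cases "even n")
        case True
        then obtain k where k: "n = 2 * k" "k > 0" using n by auto
        \<comment> \<open>With n = 2 * k, the exponent \<open>(k - 1) div 2\<close> falls short of n
          / 4 = k / 2 by at most 1, which costs the factor 1/2.\<close>
        have "2 powr (real n / 4) / 2 = 2 powr (real n / 4 - 1)" by (simp add: powr_diff)
        also have "\<dots> \<le> 2 powr real ((k - 1) div 2)"
        proof (rule powr_mono)
          have "k \<le> 2 * ((k - 1) div 2) + 2" by linarith
          then have "real k \<le> real (2 * ((k - 1) div 2) + 2)" by (rule of_nat_mono)
          then show "real n / 4 - 1 \<le> real ((k - 1) div 2)" by (simp add: k)
        qed simp
        also have "\<dots> = real (2 ^ ((k - 1) div 2))" by (simp add: powr_realpow)
        also have "\<dots> \<le> real (card (imprimitive_trunc n))"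
          using card_trunc_ge[of k] card_imprimitive_trunc_ge[OF k(2)]
          unfolding k(1) of_nat_le_iff by linarith
        finally show ?thesis using True diff[OF n] by (simp add: C_def field_simps)
      qed (simp add: C_def)
    qed
    have "C n > 0" if "n > 0" for n
      using C(1)[OF that] by linarith
    then have "eventually (\<lambda>n. C n > 0) sequentially"
      using eventually_gt_at_top[of 0] by (rule eventually_mono[rotated])
    \<comment> \<open>C lies between positive constants for n > 0, so its logarithm is
      bounded.\<close>
    moreover have "(\<lambda>n. ln (C n)) \<in> O(\<lambda>n. 1)"
    proof (rule bigoI[of _ "ln 2 + ln (1 + 4 * K)"])
      show "eventually (\<lambda>n. norm (ln (C n)) \<le> (ln 2 + ln (1 + 4 * K)) * norm (1::real)) sequentially"
        using eventually_gt_at_top[of 0]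
      proof eventually_elim
        case (elim n)
        have "ln (1/2) \<le> ln (C n)" "ln (C n) \<le> ln (1 + 4 * K)"
          using C[OF elim] by (subst ln_le_cancel_iff; simp)+
        moreover have "ln (1/2) = - ln (2::real)" by (simp add: ln_div)
        moreover have "0 \<le> ln (2::real)" "0 \<le> ln (1 + 4 * K)" using K(1) by simp_all
        ultimately have "\<bar>ln (C n)\<bar> \<le> ln 2 + ln (1 + 4 * K)" by linarith
        then show ?case by simp
      qed
    qed
    then have "(\<lambda>n. ln (C n)) \<in> o(\<lambda>n. ln (real n))"
      using const_in_smallo_ln by (rule landau_o.big_small_trans)
    ultimately show "n_pow_o1 C" by (simp add: n_pow_o1_def)
    show "real (N n) - real (A n) = C n * 2 powr (real n / 4)" if "even n" for n
      using that by (simp add: C_def)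
  qed
  ultimately show ?thesis by (intro conjI exI[of _ "\<lambda>_. c"] allI)
qed

end
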